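(* Let $n\ge 1$ be an integer, let $\mathcal{H}$ be a complex Hilbert space, and let $f\in\mathcal{D}(\mathbb{D}^n,\mathcal{H})$. Then the radial variation $$V_nf(\theta)=\int_{[0,1]^n}\|\partial_r f_r(\theta)\|_{\mathcal{H}}\,dr$$ is finite for quasi-every $\theta$, where $\partial_r=\partial_{r_1}\cdots\partial_{r_n}$ and $dr=dr_1\cdots dr_n$.
   Context: Notation: $\mathbb{N}=\{0,1,2,\dots\}$; $(\alpha,\theta)=\alpha_1\theta_1+\cdots+\alpha_n\theta_n$; $r^\alpha=r_1^{\alpha_1}\cdots r_n^{\alpha_n}$. The set $[0,2\pi)^n$ is identified with the $n$-torus $\mathbb{T}^n$ via $\theta\mapsto(e^{i\theta_1},\dots,e^{i\theta_n})$, and $d\psi$ denotes normalized Lebesgue measure on $\mathbb{T}^n$. Dirichlet space: a multiple Fourier series $f(\theta)\sim\sum_{\alpha\in\mathbb{N}^n}a_\alpha e^{i(\alpha,\theta)}$ with coefficients $a_\alpha\in\mathcal{H}$ belongs to $\mathcal{D}(\mathbb{D}^n,\mathcal{H})$ if $\sum_{\alpha\in\mathbb{N}^n}(\alpha_1+1)\cdots(\alpha_n+1)\|a_\alpha\|_{\mathcal{H}}^2<\infty$. Such an $f$ defines an $\mathcal{H}$-valued holomorphic function on $\mathbb{D}^n$; for $z=(r_1e^{i\theta_1},\dots,r_ne^{i\theta_n})$ with $r\in[0,1)^n$, one writes $f(z)=f_r(\theta)=\sum_{\alpha\in\mathbb{N}^n}a_\alpha r^\alpha e^{i(\alpha,\theta)}$.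 Capacity: for a positive measurable function $g$ on $\mathbb{T}^n$ let $$Bg(\theta)=\int_{\mathbb{T}^n}\frac{1}{|e^{i\theta_1}-e^{i\psi_1}|^{1/2}}\cdots\frac{1}{|e^{i\theta_n}-e^{i\psi_n}|^{1/2}}\,g(\psi)\,d\psi\in[0,\infty].$$ For a set $E\subset\mathbb{T}^n$ let $C(E)=\inf\{\|g\|_{L^2(\mathbb{T}^n)}^2 : g\ge 0,\ Bg(\theta)\ge 1 \text{ for all } \theta\in E\}$. A property holds quasi-everywhere (for quasi-every $\theta$) if it holds for all $\theta\in\mathbb{T}^n$ outside a set $E$ with $C(E)=0$. *)

theory Defs
  imports "HOL-Analysis.Analysis"
begin

text \<open>
  Complex Hilbert spaces. The real inner product, which determines norm and topology, is the real
  part of the complex one; \<open>cinner\<close> is conjugate-linear in its first argument.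
\<close>

class complex_hilbert_space = real_inner + complete_space +
  fixes scaleC :: "complex \<Rightarrow> 'a \<Rightarrow> 'a"  (infixr \<open>*\<^sub>C\<close> 75)
    and cinner :: "'a \<Rightarrow> 'a \<Rightarrow> complex"
  assumes scaleC_add_right: "c *\<^sub>C (x + y) = c *\<^sub>C x + c *\<^sub>C y"
    and scaleC_add_left: "(c + d) *\<^sub>C x = c *\<^sub>C x + d *\<^sub>C x"
    and scaleC_scaleC: "c *\<^sub>C d *\<^sub>C x = (c * d) *\<^sub>C x"
    and scaleC_one: "1 *\<^sub>C x = x"
    and scaleR_eq_scaleC: "r *\<^sub>R x = complex_of_real r *\<^sub>C x"
    and cinner_commute: "cinner x y = cnj (cinner y x)"
    and cinner_add_left: "cinner (x + y) z = cinner x z + cinner y z"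
    and cinner_scaleC_left: "cinner (c *\<^sub>C x) y = cnj c * cinner x y"
    and inner_eq_Re_cinner: "inner x y = Re (cinner x y)"

instantiation complex :: complex_hilbert_space
begin

definition scaleC_complex :: "complex \<Rightarrow> complex \<Rightarrow> complex"
  where "scaleC_complex c x = c * x"

definition cinner_complex :: "complex \<Rightarrow> complex \<Rightarrow> complex"
  where "cinner_complex x y = cnj x * y"

instance
  by standard
    (auto simp: scaleC_complex_def cinner_complex_def inner_complex_def scaleR_conv_of_real
      algebra_simps)

end

text \<open>
  Coordinates are indexed by \<open>{..<n}\<close>; points and multi-indices are functions that are
  \<open>undefined\<close> outside \<open>{..<n}\<close>, so that they fit the product measures \<open>PiM {..<n}\<close>.
  An element of the Dirichlet space is given by its coefficient family; the values of the
  family outside \<open>multi_indices n\<close> play no role.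
\<close>

definition multi_indices :: "nat \<Rightarrow> (nat \<Rightarrow> nat) set"
  where "multi_indices n = ({..<n} \<rightarrow>\<^sub>E UNIV)"

definition dirichlet_space :: "nat \<Rightarrow> ((nat \<Rightarrow> nat) \<Rightarrow> 'h::complex_hilbert_space) set"
  where "dirichlet_space n =
    {a. (\<lambda>\<alpha>. (\<Prod>j<n. real (\<alpha> j) + 1) * (norm (a \<alpha>))\<^sup>2) summable_on multi_indices n}"

definition radial_ext ::
    "nat \<Rightarrow> ((nat \<Rightarrow> nat) \<Rightarrow> 'h::complex_hilbert_space) \<Rightarrow> (nat \<Rightarrow> real) \<Rightarrow> (nat \<Rightarrow> real) \<Rightarrow> 'h"
  where "radial_ext n a \<theta> r =
    (\<Sum>\<^sub>\<infinity>\<alpha>\<in>multi_indices n.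
      (complex_of_real (\<Prod>j<n. r j ^ \<alpha> j) * cis (\<Sum>j<n. real (\<alpha> j) * \<theta> j)) *\<^sub>C a \<alpha>)"

text \<open>
  The derivatives are taken within \<open>{0..<1}\<close> because \<open>radial_ext\<close> is only of interest for
  \<open>r\<close> in \<open>[0,1)\<^sup>n\<close> (one-sided derivatives where a coordinate vanishes).
\<close>

definition partial_deriv ::
    "nat \<Rightarrow> ((nat \<Rightarrow> real) \<Rightarrow> 'h::real_normed_vector) \<Rightarrow> (nat \<Rightarrow> real) \<Rightarrow> 'h"
  where "partial_deriv j F r = vector_derivative (\<lambda>t. F (r(j := t))) (at (r j) within {0..<1})"

primrec mixed_partial ::
    "nat \<Rightarrow> ((nat \<Rightarrow> real) \<Rightarrow> 'h::real_normed_vector) \<Rightarrow> (nat \<Rightarrow> real) \<Rightarrow> 'h"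
  where
    "mixed_partial 0 F = F"
  | "mixed_partial (Suc m) F = mixed_partial m (partial_deriv m F)"

text \<open>
  The faces of the cube on which some coordinate equals \<open>1\<close>, where the derivative has no meaning,
  form a null set.
\<close>

definition radial_variation ::
    "nat \<Rightarrow> ((nat \<Rightarrow> nat) \<Rightarrow> 'h::complex_hilbert_space) \<Rightarrow> (nat \<Rightarrow> real) \<Rightarrow> ennreal"
  where "radial_variation n a \<theta> =
    (\<integral>\<^sup>+ r \<in> ({..<n} \<rightarrow>\<^sub>E {0..1}). ennreal (norm (mixed_partial n (radial_ext n a \<theta>) r))
      \<partial>(PiM {..<n} (\<lambda>_. lborel)))"

definition circle_measure :: "real measure"
  where "circle_measure = uniform_measure (restrict_space lborel {0..<2 * pi}) {0..<2 * pi}"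

definition torus_measure :: "nat \<Rightarrow> (nat \<Rightarrow> real) measure"
  where "torus_measure n = PiM {..<n} (\<lambda>_. circle_measure)"

lemma space_torus_measure: "space (torus_measure n) = ({..<n} \<rightarrow>\<^sub>E {0..<2 * pi})"
  by (simp add: torus_measure_def circle_measure_def space_PiM space_restrict_space)

text \<open>Division in \<^typ>\<open>ennreal\<close>: the kernel is \<open>\<infinity>\<close> where some \<open>\<theta> j = \<psi> j\<close>.\<close>

definition potential :: "nat \<Rightarrow> ((nat \<Rightarrow> real) \<Rightarrow> ennreal) \<Rightarrow> (nat \<Rightarrow> real) \<Rightarrow> ennreal"
  where "potential n g \<theta> =
    (\<integral>\<^sup>+ \<psi>. (\<Prod>j<n. 1 / ennreal (norm (cis (\<theta> j) - cis (\<psi> j)) powr (1/2))) * g \<psi>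
      \<partial>torus_measure n)"

definition capacity :: "nat \<Rightarrow> (nat \<Rightarrow> real) set \<Rightarrow> ennreal"
  where "capacity n E =
    (INF g \<in> {g \<in> borel_measurable (torus_measure n). \<forall>\<theta>\<in>E. potential n g \<theta> \<ge> 1}.
      \<integral>\<^sup>+ \<psi>. (g \<psi>)\<^sup>2 \<partial>torus_measure n)"

definition quasi_everywhere :: "nat \<Rightarrow> ((nat \<Rightarrow> real) \<Rightarrow> bool) \<Rightarrow> bool"
  where "quasi_everywhere n P \<longleftrightarrow>
    (\<exists>E \<subseteq> space (torus_measure n). capacity n E = 0 \<and>
      (\<forall>\<theta> \<in> space (torus_measure n) - E. P \<theta>))"

end

theory Submission imports Defs "HOL-Probability.Probability_Measure" begin

text \<open>
  In one variable, \<open>e\<^sup>i\<^sup>t (1 - r e\<^sup>i\<^sup>t)\<^bsup>-3/2\<^esup>\<close> has Taylor coefficients of size \<open>m\<^bsup>1/2\<^esup>\<close>, so that the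
  mixed derivative of \<open>f\<^sub>r\<close> is the convolution of the product of these kernels with a function \<open>g\<close>
  whose \<open>L\<^sup>2\<close> norm is controlled by the Dirichlet norm of \<open>f\<close>. Integrating the modulus of the
  kernel over \<open>r \<in> [0,1]\<close> gives at most \<open>8 |1 - e\<^sup>i\<^sup>t|\<^bsup>-1/2\<^esup>\<close>. By Tonelli the radial variation is thus
  dominated by the potential of an \<open>L\<^sup>2\<close> function \<open>G\<close>, and the set where the potential of \<open>G\<close> is
  infinite has capacity \<open>0\<close>, as one sees from the multiples of \<open>G\<close> by small constants.

  Boundary values of \<open>g\<close> are never formed: the coefficients are cut into finite blocks whose Dirichlet
  norms decay geometrically, and \<open>G\<close> is the sum of the norms of the resulting trigonometric polynomials.
\<close>

subsection \<open>The circle and the one-variable kernel\<close>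

lemma sets_circle_measure: "sets circle_measure = sets (restrict_space borel {0..<2 * pi})"
  by (simp add: circle_measure_def sets_restrict_space)

lemma measurable_circle_ident [measurable]: "(\<lambda>x. x) \<in> borel_measurable circle_measure"
proof -
  have "(\<lambda>x::real. x) \<in> borel_measurable (restrict_space borel {0..<2 * pi})"
    by (rule measurable_restrict_space1) simp
  then show ?thesis
    using measurable_cong_sets[OF sets_circle_measure refl, of "borel :: real measure"] by blast
qed

lemma emeasure_restrict_arc:
  "emeasure (restrict_space lborel {0..<2 * pi}) {0..<2 * pi} = ennreal (2 * pi)"
  by (subst emeasure_restrict_space) auto

lemma prob_space_circle_measure: "prob_space circle_measure"
  unfolding circle_measure_def
  by (rule prob_space_uniform_measure) (simp_all add: emeasure_restrict_arc)

lemma integral_circle_measure: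
  fixes f :: "real \<Rightarrow> 'b::{banach, second_countable_topology}"
  assumes [measurable]: "f \<in> borel_measurable borel"
  shows "(\<integral>x. f x \<partial>circle_measure) = (1 / (2 * pi)) *\<^sub>R (\<integral>x. indicator {0..<2 * pi} x *\<^sub>R f x \<partial>lborel)"
proof -
  let ?A = "{0..<2 * pi}" and ?M = "restrict_space lborel {0..<2 * pi}"
  have f: "f \<in> borel_measurable ?M"
    by (rule measurable_restrict_space1) simp
  have density: "circle_measure = density ?M (\<lambda>x. ennreal (indicator ?A x / (2 * pi)))"
    unfolding circle_measure_def uniform_measure_def emeasure_restrict_arc
    by (intro density_cong)
      (auto simp: space_restrict_space indicator_def divide_ennreal[symmetric]
        intro!: measurable_restrict_space1)
  have "(\<integral>x. f x \<partial>circle_measure) = (\<integral>x. (indicator ?A x / (2 * pi)) *\<^sub>R f x \<partial>?M)"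
    unfolding density using f
    by (rule integral_density) (auto intro!: measurable_restrict_space1)
  also have "\<dots> = (\<integral>x. (1 / (2 * pi)) *\<^sub>R f x \<partial>?M)"
    by (rule Bochner_Integration.integral_cong) (auto simp: space_restrict_space)
  also have "\<dots> = (1 / (2 * pi)) *\<^sub>R (\<integral>x. indicator ?A x *\<^sub>R f x \<partial>lborel)"
    by (simp add: integral_restrict_space)
  finally show ?thesis .
qed

lemma integrable_circle_measure:
  fixes f :: "real \<Rightarrow> complex"
  assumes [measurable]: "f \<in> borel_measurable borel" and "\<And>x. norm (f x) \<le> B"
  shows "integrable circle_measure f"
proof -
  interpret prob_space circle_measure by (rule prob_space_circle_measure)
  show ?thesis
    by (rule integrable_const_bound[where B=B]) (use assms in \<open>auto intro: measurable_compose[OF measurable_circle_ident]\<close>)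
qed

text \<open>For k \<noteq> 0 the antiderivative has period 2 pi, so the integral over a full turn
  vanishes.\<close>

lemma integral_circle_cis:
  "(\<integral>x. cis (of_int k * x) \<partial>circle_measure) = of_bool (k = 0)"
proof (cases "k = 0")
  case True
  interpret prob_space circle_measure by (rule prob_space_circle_measure)
  show ?thesis using True prob_space by simp
next
  case False
  let ?F = "\<lambda>x::real. cis (of_int k * x) / (\<i> * of_int k)"
  have "(\<integral>x. indicator {0..2*pi} x *\<^sub>R cis (of_int k * x) \<partial>lborel) = ?F (2*pi) - ?F 0"
  proof (rule integral_FTC_Icc)
    fix x :: real
    have "((\<lambda>x. exp (\<i> * of_real (of_int k * x)) / (\<i> * of_int k)) has_vector_derivative
        exp (\<i> * of_real (of_int k * x))) (at x within {0..2*pi})"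
      using False by (auto intro!: derivative_eq_intros has_vector_derivative_real_field simp: field_simps)
    then show "(?F has_vector_derivative cis (of_int k * x)) (at x within {0..2*pi})"
      by (simp add: cis_conv_exp)
  qed (auto intro!: continuous_intros)
  also have "?F (2*pi) = ?F 0"
    by (metis cis_multiple_2pi cis_zero Ints_of_int mult.commute mult_zero_right)
  finally have *: "(\<integral>x. indicator {0..2*pi} x *\<^sub>R cis (of_int k * x) \<partial>lborel) = 0" by simp
  \<comment> \<open>The fundamental theorem of calculus was applied on a closed interval; the added
    endpoint 2 pi is a null set.\<close>
  have "(\<integral>x. indicator {0..<2*pi} x *\<^sub>R cis (of_int k * x) \<partial>lborel) =
      (\<integral>x. indicator {0..2*pi} x *\<^sub>R cis (of_int k * x) \<partial>lborel)"
  proof (rule integral_cong_AE)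
    show "AE x in lborel. indicator {0..<2*pi} x *\<^sub>R cis (of_int k * x) = indicator {0..2*pi} x *\<^sub>R cis (of_int k * x)"
      using AE_lborel_singleton[of "2 * pi"] by eventually_elim (auto simp: indicator_def)
  qed (intro borel_measurable_scaleR borel_measurable_indicator borel_measurable_continuous_onI continuous_intros; simp)+
  then show ?thesis using * False
    by (subst integral_circle_measure)
      (auto intro!: borel_measurable_continuous_onI continuous_intros)
qed

section \<open>The binomial series with exponent -3/2 and its convolution formula\<close>

text \<open>The Taylor coefficients of \<open>(1 - z)\<^bsup>-3/2\<^esup>\<close>.\<close>

definition bcoef :: "nat \<Rightarrow> real"
  where "bcoef l = pochhammer (3/2) l / fact l"

lemma bcoef_Suc: "bcoef (Suc l) = bcoef l * ((real l + 3/2) / (real l + 1))"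
  by (simp add: bcoef_def pochhammer_Suc field_simps)

lemma bcoef_pos: "bcoef l > 0"
  unfolding bcoef_def by (intro divide_pos_pos pochhammer_pos) auto

text \<open>The squared ratio of consecutive coefficients is at least (l+2)/(l+1), because
  (l+2)(l+1) \<le> (l+3/2)^2, so the bound propagates from equality at l = 0.\<close>

lemma bcoef_square_ge: "(bcoef l)\<^sup>2 \<ge> real l + 1"
proof (induction l)
  case (Suc l)
  have "real (Suc l) + 1 \<le> (real l + 1) * ((real l + 3/2) / (real l + 1))\<^sup>2"
  proof -
    have "(real l + 2) * (real l + 1) \<le> (real l + 3/2)\<^sup>2"
      by (simp add: power2_eq_square algebra_simps)
    then show ?thesis
      by (simp add: power_divide power2_eq_square le_divide_eq add.commute)
  qed
  also have "\<dots> \<le> (bcoef l)\<^sup>2 * ((real l + 3/2) / (real l + 1))\<^sup>2"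
    by (rule mult_right_mono[OF Suc]) simp
  finally show ?case by (simp only: bcoef_Suc power_mult_distrib)
qed (simp add: bcoef_def)

text \<open>The extra factor \<open>cis t\<close> shifts every frequency from l to l+1, so that
  frequency m comes with the power r^(m-1) that remains after differentiating r^m.\<close>

definition bker :: "real \<Rightarrow> real \<Rightarrow> complex"
  where "bker r t = cis t * (1 - of_real r * cis t) powr (-3/2)"

lemma bcoef_sums:
  fixes z :: complex
  assumes "norm z < 1"
  shows "(\<lambda>l. of_real (bcoef l) * z ^ l) sums ((1 - z) powr (-3/2))"
proof -
  have "(\<lambda>l. (-3/2 gchoose l) * (- z) ^ l) sums ((1 + - z) powr (-3/2))"
    by (rule gen_binomial_complex) (simp add: assms)
  moreover have "(-3/2 gchoose l) * (- z) ^ l = of_real (bcoef l) * z ^ l" for l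
  proof -
    have p: "pochhammer (3/2) l = complex_of_real (pochhammer (3/2) l)"
      using pochhammer_of_real[of "3/2" l, where 'a=complex] by simp
    \<comment> \<open>The sign (-1)^l in the generalized binomial coefficient cancels the one in
      (-z)^l.\<close>
    have "(-3/2 gchoose l) * (- z) ^ l = ((- 1) ^ l * (- 1) ^ l) * (pochhammer (3/2) l / fact l * z ^ l)"
      unfolding gbinomial_pochhammer power_minus[of z] by simp
    also have "(- 1) ^ l * (- 1) ^ l = (1::complex)"
      by (simp flip: power_mult_distrib)
    finally show ?thesis
      by (simp add: bcoef_def p)
  qed
  ultimately show ?thesis by simp
qed

lemma bcoef_summable:
  assumes "0 \<le> r" "r < 1"
  shows "summable (\<lambda>l. bcoef l * r ^ l)"
proof -
  have "summable (\<lambda>l. complex_of_real (bcoef l) * of_real r ^ l)"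
    by (rule sums_summable, rule bcoef_sums) (use assms in auto)
  then have "summable (\<lambda>l. complex_of_real (bcoef l * r ^ l))" by simp
  then show ?thesis by (simp only: summable_complex_of_real)
qed

lemma bker_sums:
  assumes "0 \<le> r" "r < 1"
  shows "(\<lambda>l. of_real (bcoef l * r ^ l) * cis (real (l + 1) * t)) sums bker r t"
proof -
  have "(\<lambda>l. cis t * (of_real (bcoef l) * (of_real r * cis t) ^ l)) sums bker r t"
    unfolding bker_def
    by (rule sums_mult, rule bcoef_sums) (use assms in \<open>simp add: norm_mult\<close>)
  moreover have "cis t * (of_real (bcoef l) * (of_real r * cis t) ^ l)
      = of_real (bcoef l * r ^ l) * cis (real (l + 1) * t)" for l
    using cis_mult[of t "real l * t"]
    by (simp add: power_mult_distrib Complex.DeMoivre ring_distribs)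
  ultimately show ?thesis by simp
qed

text \<open>The Fourier multiplier that turns the kernel coefficient \<open>bcoef (m - 1)\<close>
  into the factor m produced by differentiation; it vanishes at m = 0.\<close>

definition mult_coef :: "nat \<Rightarrow> real"
  where "mult_coef m = real m / bcoef (m - 1)"

text \<open>The exponent 3/2 balances the Dirichlet weight here: the numerator contributes m^2, and
  \<open>bcoef_square_ge\<close> at m - 1 gives back a factor m. The multiplier thus maps the
  weighted square-summable coefficients to unweighted ones.\<close>

lemma mult_coef_square_le: "(mult_coef m)\<^sup>2 \<le> real m + 1"
proof (cases m)
  case (Suc l)
  have "(real m)\<^sup>2 \<le> real m * (bcoef l)\<^sup>2"
    using bcoef_square_ge[of l] Suc by (simp add: power2_eq_square mult_left_mono)
  then have "(mult_coef m)\<^sup>2 \<le> real m"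
    using bcoef_pos[of l] Suc by (simp add: mult_coef_def power_divide divide_le_eq)
  then show ?thesis by simp
qed (simp add: mult_coef_def)

lemma norm_bker: "norm (bker r t) = norm (1 - of_real r * cis t) powr (-3/2)"
  by (simp add: bker_def norm_mult norm_powr_real_powr')

text \<open>A crude bound, uniform in t for fixed r, that serves only integrability; the bound that
  is sharp near t = 0 is \<open>norm_bker_le\<close>.\<close>

lemma norm_bker_le_suminf:
  assumes "0 \<le> r" "r < 1"
  shows "norm (bker r t) \<le> (\<Sum>l. bcoef l * r ^ l)"
proof -
  have n: "norm (of_real (bcoef l * r ^ l) * cis (real (l + 1) * t)) = bcoef l * r ^ l" for l
    using bcoef_pos[of l] assms by (simp add: norm_mult norm_power)
  show ?thesis
    using summable_norm[of "\<lambda>l. of_real (bcoef l * r ^ l) * cis (real (l + 1) * t)"]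
      bcoef_summable[OF assms] sums_unique[OF bker_sums[OF assms, of t]]
    unfolding n by simp
qed

text \<open>The series exhibits the kernel as a pointwise limit of continuous functions, so the
  branch cut of \<open>powr\<close> never enters.\<close>

lemma borel_measurable_bker:
  assumes "0 \<le> r" "r < 1"
  shows "(\<lambda>t. bker r t) \<in> borel_measurable borel"
proof -
  have "bker r t = (\<Sum>l. of_real (bcoef l * r ^ l) * cis (real (l + 1) * t))" for t
    using sums_unique[OF bker_sums[OF assms]] .
  moreover have "(\<lambda>t. cis (real (l + 1) * t)) \<in> borel_measurable borel" for l
    by (intro borel_measurable_continuous_onI continuous_intros)
  ultimately show ?thesis
    by (simp del: of_nat_add)
qed

text \<open>Absolute convergence for r < 1 allows integration term by term. Orthogonality leaves
  only the term of frequency m, and the multiplier corrects its coefficient.\<close>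

lemma integral_bker:
  assumes "0 \<le> r" "r < 1"
  shows "(\<integral>\<psi>. of_real (mult_coef m) * (bker r (\<theta> - \<psi>) * cis (real m * \<psi>)) \<partial>circle_measure) =
    of_real (real m * r ^ (m - 1)) * cis (real m * \<theta>)"
proof -
  interpret prob_space circle_measure by (rule prob_space_circle_measure)
  define f where "f l \<psi> = of_real (mult_coef m * (bcoef l * r ^ l)) * cis (real (l + 1) * \<theta>)
      * cis (of_int (int m - int l - 1) * \<psi>)" for l \<psi>
  have f_sums: "(\<lambda>l. f l \<psi>) sums (of_real (mult_coef m) * (bker r (\<theta> - \<psi>) * cis (real m * \<psi>)))" for \<psi>
  proof -
    have "cis (real (l + 1) * (\<theta> - \<psi>)) * cis (real m * \<psi>) = cis (real (l + 1) * \<theta>)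
      * cis (of_int (int m - int l - 1) * \<psi>)" for l
      by (simp add: cis_mult algebra_simps)
    then have "f l \<psi> = of_real (mult_coef m) *
        ((of_real (bcoef l * r ^ l) * cis (real (l + 1) * (\<theta> - \<psi>))) * cis (real m * \<psi>))" for l
      by (simp only: f_def mult.assoc of_real_mult)
    then show ?thesis
      by (simp only:) (intro sums_mult sums_mult2 bker_sums assms)
  qed
  have nf: "norm (f l \<psi>) = \<bar>mult_coef m\<bar> * (bcoef l * r ^ l)" for l \<psi>
    using bcoef_pos[of l] assms by (simp add: f_def norm_mult norm_power abs_mult)
  have [measurable]: "f l \<in> borel_measurable borel" for l
    unfolding f_def by (intro borel_measurable_continuous_onI continuous_intros)
  have int: "integrable circle_measure (f l)" for l
    by (rule integrable_circle_measure) (auto simp: nf)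
  have "(\<lambda>l. \<integral>\<psi>. f l \<psi> \<partial>circle_measure) sums (\<integral>\<psi>. (\<Sum>l. f l \<psi>) \<partial>circle_measure)"
    by (rule sums_integral[OF int])
       (use prob_space in \<open>auto simp: nf intro!: summable_mult bcoef_summable assms\<close>)
  moreover have "(\<Sum>l. f l \<psi>) = of_real (mult_coef m) * (bker r (\<theta> - \<psi>) * cis (real m * \<psi>))" for \<psi>
    using sums_unique[OF f_sums] by simp
  \<comment> \<open>For m = 0 no frequency l + 1 matches; the formula stays correct at l = m - 1 = 0
    because of its factor \<open>real m\<close>.\<close>
  moreover have "(\<integral>\<psi>. f l \<psi> \<partial>circle_measure) =
      (if l = m - 1 then of_real (real m * r ^ (m - 1)) * cis (real m * \<theta>) else 0)" for l
  proof -
    have "(\<integral>\<psi>. f l \<psi> \<partial>circle_measure) =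
      of_real (mult_coef m * (bcoef l * r ^ l)) * cis (real (l + 1) * \<theta>) * of_bool (int m - int l - 1 = 0)"
      unfolding f_def integral_mult_right_zero integral_circle_cis ..
    then show ?thesis
      using bcoef_pos[of l] by (cases m) (auto simp: mult_coef_def)
  qed
  ultimately have "(\<lambda>l. if l = m - 1 then of_real (real m * r ^ (m - 1)) * cis (real m * \<theta>) else 0) sums
     (\<integral>\<psi>. of_real (mult_coef m) * (bker r (\<theta> - \<psi>) * cis (real m * \<psi>)) \<partial>circle_measure)"
    by simp
  then show ?thesis
    using sums_single[of "m - 1" "\<lambda>_. of_real (real m * r ^ (m - 1)) * cis (real m * \<theta>)"] sums_unique2
    by blast
qed

section \<open>The majorant of the kernel and its radial integral\<close>

text \<open>With \<open>\<delta> = |1 - e\<^sup>i\<^sup>t|\<close>, both \<open>1 - r\<close> and \<open>\<delta> / 2\<close> are lower bounds for \<open>|1 - r e\<^sup>i\<^sup>t|\<close>, hence so is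
  their mean.\<close>

definition dom_ker :: "real \<Rightarrow> real \<Rightarrow> real"
  where "dom_ker \<delta> r = (((1 - r) + \<delta> / 2) / 2) powr (-3/2)"

lemma dom_ker_nonneg: "0 \<le> dom_ker \<delta> r"
  by (simp add: dom_ker_def)

lemma norm_bker_le:
  assumes "0 \<le> r" "r < 1"
  shows "norm (bker r (x - y)) \<le> dom_ker (norm (cis x - cis y)) r"
proof -
  let ?w = "norm (1 - of_real r * cis (x - y))"
  have d: "norm (cis x - cis y) = norm (1 - cis (x - y))"
  proof -
    have "cis x - cis y = - cis y * (1 - cis (x - y))"
      by (simp add: algebra_simps cis_mult)
    then show ?thesis by (simp add: norm_mult)
  qed
  have 1: "1 - r \<le> ?w"
    using norm_triangle_ineq2[of 1 "of_real r * cis (x - y)"] assms by (simp add: norm_mult)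
  \<comment> \<open>Write 1 - cis as (1 - r cis) - (1 - r) cis. As 1 - r \<le> \<open>?w\<close>,
    this gives at most \<open>2 * ?w\<close>.\<close>
  have "norm (1 - cis (x - y)) \<le> ?w + norm (of_real (1 - r) * cis (x - y))"
    using norm_triangle_ineq4[of "1 - of_real r * cis (x - y)" "of_real (1 - r) * cis (x - y)"]
    by (simp add: algebra_simps)
  then have "norm (1 - cis (x - y)) \<le> ?w + (1 - r)"
    using assms by (simp only: norm_mult norm_cis norm_of_real) simp
  with 1 have 2: "((1 - r) + norm (cis x - cis y) / 2) / 2 \<le> ?w"
    by (simp add: d)
  have 3: "0 < ((1 - r) + norm (cis x - cis y) / 2) / 2"
    using assms by (simp add: add_pos_nonneg)
  show ?thesis unfolding norm_bker dom_ker_def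
    by (rule powr_mono2'[OF _ 3 2]) simp
qed

lemma nn_integral_dom_ker_le:
  assumes "0 \<le> \<delta>"
  shows "(\<integral>\<^sup>+r\<in>{0..1}. ennreal (dom_ker \<delta> r) \<partial>lborel) \<le> 8 * (1 / ennreal (\<delta> powr (1/2)))"
proof (cases "\<delta> = 0")
  case False
  with assms have d: "\<delta> > 0" by simp
  \<comment> \<open>The base has slope -1/2 in r, so differentiating its power -1/2 produces a
    factor 1/4, which the 4 compensates. The value at 0 is dropped below, being nonnegative.\<close>
  let ?F = "\<lambda>r. 4 * (((1 - r) + \<delta> / 2) / 2) powr (-1/2)"
  have "(\<integral>\<^sup>+r\<in>{0..1}. ennreal (dom_ker \<delta> r) \<partial>lborel) = ?F 1 - ?F 0"
  proof (rule nn_integral_FTC_Icc)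
    fix r :: real assume "r \<in> {0..1}"
    with d have p: "((1 - r) + \<delta> / 2) / 2 > 0" by simp
    have "(?F has_real_derivative 4 * (-1/2 * (((1 - r) + \<delta> / 2) / 2) powr (-1/2 - 1) * (-1/2))) (at r)"
      using p by (auto intro!: derivative_eq_intros)
    then show "(?F has_real_derivative dom_ker \<delta> r) (at r)"
      by (simp add: dom_ker_def)
  qed (auto simp: dom_ker_def)
  also have "\<dots> \<le> ennreal (?F 1)"
    by (rule ennreal_leI) simp
  also have "?F 1 = 8 / \<delta> powr (1/2)"
  proof -
    have "(4::real) powr (1/2) = 2"
      using powr_half_sqrt[of 4] by simp
    then show ?thesis using d by (simp add: powr_divide powr_minus_divide)
  qed
  also have "ennreal (8 / \<delta> powr (1/2)) = 8 * (1 / ennreal (\<delta> powr (1/2)))"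
  proof -
    have "ennreal (8 / \<delta> powr (1/2)) = ennreal (8 * (1 / \<delta> powr (1/2)))" by simp
    also have "\<dots> = ennreal 8 * ennreal (1 / \<delta> powr (1/2))"
      using d by (intro ennreal_mult) auto
    also have "\<dots> = 8 * (1 / ennreal (\<delta> powr (1/2)))"
      using d by (subst divide_ennreal[symmetric]) auto
    finally show ?thesis .
  qed
  finally show ?thesis .
\<comment> \<open>If \<delta> = 0, the right-hand side is infinite, since 1 / 0 = \<infinity> in
  \<open>ennreal\<close>.\<close>
qed (simp add: ennreal_mult_top)

subsection \<open>Trigonometric polynomials on the torus\<close>

lemma cinner_add_right: "cinner x (y + z) = cinner x y + cinner x z"
  by (metis cinner_add_left cinner_commute complex_cnj_add)

lemma cinner_zero_left [simp]: "cinner 0 y = 0"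
  using cinner_add_left[of 0 0 y] by simp

lemma cinner_zero_right [simp]: "cinner x 0 = 0"
  using cinner_add_right[of x 0 0] by simp

lemma cinner_scaleC_right: "cinner x (c *\<^sub>C y) = c * cinner x y"
  by (metis cinner_commute cinner_scaleC_left complex_cnj_cnj complex_cnj_mult)

lemma cinner_sum_left: "cinner (\<Sum>i\<in>A. f i) y = (\<Sum>i\<in>A. cinner (f i) y)"
  by (induction A rule: infinite_finite_induct) (auto simp: cinner_add_left)

lemma cinner_sum_right: "cinner x (\<Sum>i\<in>A. f i) = (\<Sum>i\<in>A. cinner x (f i))"
  by (induction A rule: infinite_finite_induct) (auto simp: cinner_add_right)

lemma norm_power2_eq_cinner: "(norm x)\<^sup>2 = Re (cinner x x)"
  for x :: "'h::complex_hilbert_space"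
  by (simp add: power2_norm_eq_inner inner_eq_Re_cinner)

lemma norm_scaleC: "norm (c *\<^sub>C x) = norm c * norm x"
  for x :: "'h::complex_hilbert_space"
proof -
  have "cinner (c *\<^sub>C x) (c *\<^sub>C x) = of_real ((norm c)\<^sup>2) * cinner x x"
    using complex_norm_square[of c]
    by (simp add: cinner_scaleC_left cinner_scaleC_right mult.commute mult.left_commute)
  then have "(norm (c *\<^sub>C x))\<^sup>2 = (norm c)\<^sup>2 * Re (cinner x x)"
    by (simp add: norm_power2_eq_cinner flip: of_real_power)
  then show ?thesis
    by (simp add: norm_power2_eq_cinner[symmetric] power_mult_distrib[symmetric])
qed

text \<open>A unimodular factor rotates the complex product onto the nonnegative real axis, where
  the real Cauchy-Schwarz inequality for \<open>inner\<close> applies.\<close>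

lemma norm_cinner_le: "norm (cinner x y) \<le> norm x * norm y"
  for x :: "'h::complex_hilbert_space"
proof -
  obtain c where c: "norm c = 1" "c * cinner x y = of_real (norm (cinner x y))"
  proof (cases "cinner x y = 0")
    case False
    then show ?thesis
      using that[of "cnj (sgn (cinner x y))"] complex_norm_square[of "cinner x y"]
      by (simp add: norm_sgn) (simp add: sgn_eq divide_eq_eq power2_eq_square mult.commute)
  qed (use that[of 1] in auto)
  have "norm (cinner x y) = Re (cinner x (c *\<^sub>C y))"
    by (simp add: cinner_scaleC_right c)
  also have "\<dots> = inner x (c *\<^sub>C y)"
    by (simp add: inner_eq_Re_cinner)
  also have "\<dots> \<le> norm x * norm (c *\<^sub>C y)"
    by (rule norm_cauchy_schwarz)
  finally show ?thesis by (simp add: norm_scaleC c)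
qed

lemma inner_sgn_self: "norm x = inner (sgn x) x"
  by (cases "x = 0") (simp_all add: sgn_div_norm power2_norm_eq_inner[symmetric] power2_eq_square)

section \<open>Characters and the Parseval identity on the torus\<close>

lemma cis_sum: "cis (\<Sum>j\<in>A. f j) = (\<Prod>j\<in>A. cis (f j))"
  by (induction A rule: infinite_finite_induct) (auto simp: cis_mult[symmetric])

interpretation circle_product: product_sigma_finite "\<lambda>_::nat. circle_measure"
  by (intro product_sigma_finite.intro prob_space_imp_sigma_finite prob_space_circle_measure)

lemma prob_space_torus_measure: "prob_space (torus_measure n)"
proof
  have "emeasure circle_measure (space circle_measure) = 1"
    using prob_space_circle_measure by (rule prob_space.emeasure_space_1)
  then show "emeasure (torus_measure n) (space (torus_measure n)) = 1"
    unfolding torus_measure_def space_PiM by (subst circle_product.emeasure_PiM) auto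
qed

lemma measurable_torus_component [measurable]:
  "j < n \<Longrightarrow> (\<lambda>\<psi>. \<psi> j) \<in> borel_measurable (torus_measure n)"
  unfolding torus_measure_def
  by (rule measurable_compose[where f="\<lambda>\<psi>. \<psi> j" and N=circle_measure])
    (auto intro: measurable_component_singleton[where M="\<lambda>_. circle_measure"])

lemma integral_torus_prod:
  fixes f :: "nat \<Rightarrow> real \<Rightarrow> complex"
  assumes "\<And>j. j < n \<Longrightarrow> integrable circle_measure (f j)"
  shows "(\<integral>\<psi>. (\<Prod>j<n. f j (\<psi> j)) \<partial>torus_measure n) = (\<Prod>j<n. integral\<^sup>L circle_measure (f j))"
    and "integrable (torus_measure n) (\<lambda>\<psi>. \<Prod>j<n. f j (\<psi> j))"
  unfolding torus_measure_def using assms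
  by (auto intro!: circle_product.product_integral_prod circle_product.product_integrable_prod)

text \<open>The integrand factors over the coordinates, and each factor integrates to 1 or 0.
  Multi-indices are extensional, hence equal once their first n coordinates agree.\<close>

lemma integral_torus_character:
  assumes "\<alpha> \<in> multi_indices n" "\<beta> \<in> multi_indices n"
  defines "f \<equiv> \<lambda>\<psi>. cnj (cis (\<Sum>j<n. real (\<alpha> j) * \<psi> j)) * cis (\<Sum>j<n. real (\<beta> j) * \<psi> j)"
  shows "integrable (torus_measure n) f"
    and "(\<integral>\<psi>. f \<psi> \<partial>torus_measure n) = of_bool (\<alpha> = \<beta>)"
proof -
  have f: "f = (\<lambda>\<psi>. \<Prod>j<n. cis (of_int (int (\<beta> j) - int (\<alpha> j)) * \<psi> j))"
    by (simp add: fun_eq_iff f_def cis_cnj cis_mult cis_sum[symmetric] sum_subtractf algebra_simps)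
  have int: "integrable circle_measure (\<lambda>x. cis (of_int k * x))" for k
    by (rule integrable_circle_measure[where B=1])
      (auto intro!: borel_measurable_continuous_onI continuous_intros)
  show "integrable (torus_measure n) f"
    unfolding f by (rule integral_torus_prod(2)) (rule int)
  have "(\<integral>\<psi>. f \<psi> \<partial>torus_measure n) = (\<Prod>j<n. of_bool (\<alpha> j = \<beta> j))"
    unfolding f by (subst integral_torus_prod(1), rule int, subst integral_circle_cis) (auto intro!: prod.cong)
  also have "\<dots> = of_bool (\<forall>j<n. \<alpha> j = \<beta> j)"
    by (auto simp: of_bool_def prod_zero_iff)
  also have "(\<forall>j<n. \<alpha> j = \<beta> j) \<longleftrightarrow> \<alpha> = \<beta>"
    using assms(1,2) by (auto simp: multi_indices_def intro: PiE_ext)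
  finally show "(\<integral>\<psi>. f \<psi> \<partial>torus_measure n) = of_bool (\<alpha> = \<beta>)" .
qed

definition trig_poly ::
    "nat \<Rightarrow> (nat \<Rightarrow> nat) set \<Rightarrow> ((nat \<Rightarrow> nat) \<Rightarrow> 'h::complex_hilbert_space) \<Rightarrow> (nat \<Rightarrow> real) \<Rightarrow> 'h"
  where "trig_poly n A b \<psi> = (\<Sum>\<alpha>\<in>A. cis (\<Sum>j<n. real (\<alpha> j) * \<psi> j) *\<^sub>C b \<alpha>)"

lemma norm_trig_poly_power2:
  "(norm (trig_poly n A b \<psi>))\<^sup>2 = Re (\<Sum>\<alpha>\<in>A. \<Sum>\<beta>\<in>A.
    (cnj (cis (\<Sum>j<n. real (\<alpha> j) * \<psi> j)) * cis (\<Sum>j<n. real (\<beta> j) * \<psi> j)) * cinner (b \<alpha>) (b \<beta>))"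
  by (simp only: norm_power2_eq_cinner trig_poly_def cinner_sum_left)
    (simp only: cinner_sum_right cinner_scaleC_left cinner_scaleC_right sum_distrib_left mult_ac)

lemma measurable_torus_character [measurable]:
  "(\<lambda>\<psi>. cis (\<Sum>j<n. real (\<alpha> j) * \<psi> j)) \<in> borel_measurable (torus_measure n)"
proof -
  have "cis \<in> borel_measurable borel"
    by (intro borel_measurable_continuous_onI continuous_intros)
  then show ?thesis
    by (rule measurable_compose[rotated])
      (auto intro!: borel_measurable_sum borel_measurable_times measurable_torus_component)
qed

text \<open>The squared norm is a finite double sum of scalar characters, so measurability of the
  vector-valued polynomial itself is never at issue.\<close>

lemma measurable_norm_trig_poly [measurable]:
  "(\<lambda>\<psi>. norm (trig_poly n A b \<psi>)) \<in> borel_measurable (torus_measure n)"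
proof -
  have "(\<lambda>\<psi>. sqrt ((norm (trig_poly n A b \<psi>))\<^sup>2)) \<in> borel_measurable (torus_measure n)"
    unfolding norm_trig_poly_power2
    by (intro measurable_compose[OF _ borel_measurable_sqrt] measurable_compose[OF _ borel_measurable_Re]
      borel_measurable_sum borel_measurable_times borel_measurable_const measurable_torus_character
      measurable_compose[OF measurable_torus_character borel_measurable_continuous_onI[of cnj]]
      continuous_intros)
  then show ?thesis by simp
qed

text \<open>Parseval: in the expanded square, orthogonality leaves only the diagonal. For infinite
  \<open>A\<close> both sums are 0 by convention.\<close>

lemma nn_integral_trig_poly:
  assumes "A \<subseteq> multi_indices n"
  shows "(\<integral>\<^sup>+\<psi>. (ennreal (norm (trig_poly n A b \<psi>)))\<^sup>2 \<partial>torus_measure n) = ennreal (\<Sum>\<alpha>\<in>A. (norm (b \<alpha>))\<^sup>2)"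
proof (cases "finite A")
  case True
  let ?e = "\<lambda>\<alpha> \<beta> \<psi>. cnj (cis (\<Sum>j<n. real (\<alpha> j) * \<psi> j)) * cis (\<Sum>j<n. real (\<beta> j) * \<psi> j)"
  let ?H = "\<lambda>\<psi>. \<Sum>\<alpha>\<in>A. \<Sum>\<beta>\<in>A. ?e \<alpha> \<beta> \<psi> * cinner (b \<alpha>) (b \<beta>)"
  have int1: "integrable (torus_measure n) (\<lambda>\<psi>. ?e \<alpha> \<beta> \<psi> * cinner (b \<alpha>) (b \<beta>))" if "\<alpha> \<in> A" "\<beta> \<in> A" for \<alpha> \<beta>
    using that assms by (intro integrable_mult_left integral_torus_character) auto
  have int: "integrable (torus_measure n) ?H"
    by (intro Bochner_Integration.integrable_sum int1)
  have "(\<integral>\<psi>. ?H \<psi> \<partial>torus_measure n) = (\<Sum>\<alpha>\<in>A. \<Sum>\<beta>\<in>A. \<integral>\<psi>. ?e \<alpha> \<beta> \<psi> * cinner (b \<alpha>) (b \<beta>) \<partial>torus_measure n)"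
    by (subst Bochner_Integration.integral_sum, (intro Bochner_Integration.integrable_sum int1; assumption))
       (intro sum.cong refl Bochner_Integration.integral_sum int1)
  also have "\<dots> = (\<Sum>\<alpha>\<in>A. \<Sum>\<beta>\<in>A. of_bool (\<alpha> = \<beta>) * cinner (b \<alpha>) (b \<beta>))"
    using assms
    by (intro sum.cong refl) (subst integral_mult_left_zero, subst integral_torus_character, auto)
  also have "\<dots> = (\<Sum>\<alpha>\<in>A. cinner (b \<alpha>) (b \<alpha>))"
    using True by (simp add: of_bool_def if_distrib[of "\<lambda>x. x * _"] cong: if_cong)
  finally have "Re (\<integral>\<psi>. ?H \<psi> \<partial>torus_measure n) = (\<Sum>\<alpha>\<in>A. (norm (b \<alpha>))\<^sup>2)"
    by (simp add: norm_power2_eq_cinner)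
  then have I: "(\<integral>\<psi>. (norm (trig_poly n A b \<psi>))\<^sup>2 \<partial>torus_measure n) = (\<Sum>\<alpha>\<in>A. (norm (b \<alpha>))\<^sup>2)"
    unfolding norm_trig_poly_power2 using int by (subst integral_Re) auto
  have "integrable (torus_measure n) (\<lambda>\<psi>. (norm (trig_poly n A b \<psi>))\<^sup>2)"
    unfolding norm_trig_poly_power2 using int by (rule integrable_Re)
  then show ?thesis
    by (simp add: ennreal_power nn_integral_eq_integral I)
qed (simp add: trig_poly_def)

text \<open>Pairing with a fixed vector reduces the bound to scalar integrals; the Hilbert space is not
  assumed to be separable, so vector-valued Bochner integrals are not available.\<close>

lemma norm_block_le:
  fixes a :: "(nat \<Rightarrow> nat) \<Rightarrow> 'h::complex_hilbert_space"
  assumes r: "\<And>j. j < n \<Longrightarrow> 0 \<le> r j \<and> r j < 1"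
  shows "ennreal (norm (\<Sum>\<alpha>\<in>A. ((\<Prod>j<n. of_real (real (\<alpha> j) * r j ^ (\<alpha> j - 1))) *
      cis (\<Sum>j<n. real (\<alpha> j) * \<theta> j)) *\<^sub>C a \<alpha>))
    \<le> (\<integral>\<^sup>+\<psi>. (\<Prod>j<n. ennreal (dom_ker (norm (cis (\<theta> j) - cis (\<psi> j))) (r j))) *
        ennreal (norm (trig_poly n A (\<lambda>\<alpha>. of_real (\<Prod>j<n. mult_coef (\<alpha> j)) *\<^sub>C a \<alpha>) \<psi>)) \<partial>torus_measure n)"
    (is "ennreal (norm ?x) \<le> ?R")
proof -
  let ?b = "\<lambda>\<alpha>. of_real (\<Prod>j<n. mult_coef (\<alpha> j)) *\<^sub>C a \<alpha>"
  \<comment> \<open>Pairing with this vector returns the norm of the block, while its own norm is at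
    most 1, so no constant is lost.\<close>
  define u where "u = sgn ?x"
  let ?f = "\<lambda>\<alpha> j y. of_real (mult_coef (\<alpha> j)) * (bker (r j) (\<theta> j - y) * cis (real (\<alpha> j) * y))"
  define h where "h \<psi> = (\<Sum>\<alpha>\<in>A. (\<Prod>j<n. ?f \<alpha> j (\<psi> j)) * cinner u (a \<alpha>))" for \<psi>
  have int0: "integrable circle_measure (?f \<alpha> j)" if "j < n" for \<alpha> j
  proof (rule integrable_circle_measure)
    have "(\<lambda>y. bker (r j) (\<theta> j - y)) \<in> borel_measurable borel"
      using borel_measurable_bker[of "r j"] r[OF that]
      by (auto intro: measurable_compose[rotated])
    moreover have "(\<lambda>y. cis (real (\<alpha> j) * y)) \<in> borel_measurable borel"
      by (intro borel_measurable_continuous_onI continuous_intros)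
    ultimately show "?f \<alpha> j \<in> borel_measurable borel"
      by (intro borel_measurable_times borel_measurable_const)
    show "norm (?f \<alpha> j y) \<le> \<bar>mult_coef (\<alpha> j)\<bar> * (\<Sum>l. bcoef l * r j ^ l)" for y
      using norm_bker_le_suminf[of "r j" "\<theta> j - y"] r[OF that]
      by (auto simp: norm_mult intro!: mult_left_mono)
  qed
  have int1: "integrable (torus_measure n) (\<lambda>\<psi>. (\<Prod>j<n. ?f \<alpha> j (\<psi> j)) * cinner u (a \<alpha>))" for \<alpha>
    by (intro integrable_mult_left integral_torus_prod(2) int0)
  have int: "integrable (torus_measure n) h"
    unfolding h_def by (intro Bochner_Integration.integrable_sum int1)
  \<comment> \<open>First reading of \<open>h\<close>: integrated term by term, each coordinate
    yields a differentiated monomial by \<open>integral_bker\<close>.\<close>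
  have "(\<integral>\<psi>. h \<psi> \<partial>torus_measure n) = (\<Sum>\<alpha>\<in>A. (\<integral>\<psi>. (\<Prod>j<n. ?f \<alpha> j (\<psi> j)) \<partial>torus_measure n) * cinner u (a \<alpha>))"
    unfolding h_def by (subst Bochner_Integration.integral_sum, rule int1) simp
  also have "\<dots> = (\<Sum>\<alpha>\<in>A. (\<Prod>j<n. of_real (real (\<alpha> j) * r j ^ (\<alpha> j - 1)) * cis (real (\<alpha> j) * \<theta> j)) * cinner u (a \<alpha>))"
  proof (intro sum.cong refl arg_cong2[where f="(*)"])
    fix \<alpha>
    show "(\<integral>\<psi>. (\<Prod>j<n. ?f \<alpha> j (\<psi> j)) \<partial>torus_measure n) =
        (\<Prod>j<n. of_real (real (\<alpha> j) * r j ^ (\<alpha> j - 1)) * cis (real (\<alpha> j) * \<theta> j))"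
      by (subst integral_torus_prod(1), rule int0)
        (use r in \<open>auto intro!: prod.cong simp: integral_bker simp del: of_real_mult integral_mult_right_zero\<close>)
  qed
  also have "\<dots> = cinner u ?x"
    by (simp only: cinner_sum_right cinner_scaleC_right prod.distrib cis_sum)
  finally have I: "(\<integral>\<psi>. h \<psi> \<partial>torus_measure n) = cinner u ?x" .
  \<comment> \<open>Second reading of \<open>h\<close>: the kernels are common to all \<alpha>, so
    they factor out and leave the polynomial with the multiplied coefficients
    \<open>?b\<close>.\<close>
  have h: "h \<psi> = (\<Prod>j<n. bker (r j) (\<theta> j - \<psi> j)) * cinner u (trig_poly n A ?b \<psi>)" for \<psi>
    by (simp add: h_def trig_poly_def cinner_sum_right cinner_scaleC_right prod.distrib cis_sum
        sum_distrib_left mult_ac)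
  have "norm ?x = inner u ?x"
    unfolding u_def by (rule inner_sgn_self)
  also have "\<dots> \<le> norm (cinner u ?x)"
    unfolding inner_eq_Re_cinner by (rule complex_Re_le_cmod)
  finally have "ennreal (norm ?x) \<le> ennreal (norm (\<integral>\<psi>. h \<psi> \<partial>torus_measure n))"
    unfolding I by (rule ennreal_leI)
  also have "\<dots> \<le> (\<integral>\<^sup>+\<psi>. ennreal (norm (h \<psi>)) \<partial>torus_measure n)"
    by (rule integral_norm_bound_ennreal[OF int])
  also have "\<dots> \<le> ?R"
  proof (rule nn_integral_mono)
    fix \<psi>
    have "norm (cinner u (trig_poly n A ?b \<psi>)) \<le> norm u * norm (trig_poly n A ?b \<psi>)"
      by (rule norm_cinner_le)
    also have "\<dots> \<le> norm (trig_poly n A ?b \<psi>)"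
      by (simp add: u_def norm_sgn)
    finally have "norm (h \<psi>) \<le> (\<Prod>j<n. dom_ker (norm (cis (\<theta> j) - cis (\<psi> j))) (r j)) * norm (trig_poly n A ?b \<psi>)"
      unfolding h norm_mult prod_norm[symmetric]
      using r by (intro mult_mono prod_mono prod_nonneg) (auto intro: norm_bker_le dom_ker_nonneg)
    then have "ennreal (norm (h \<psi>)) \<le> ennreal ((\<Prod>j<n. dom_ker (norm (cis (\<theta> j) - cis (\<psi> j))) (r j)) * norm (trig_poly n A ?b \<psi>))"
      by (rule ennreal_leI)
    also have "\<dots> = (\<Prod>j<n. ennreal (dom_ker (norm (cis (\<theta> j) - cis (\<psi> j))) (r j))) * ennreal (norm (trig_poly n A ?b \<psi>))"
      by (subst ennreal_mult) (auto simp: prod_ennreal dom_ker_def intro!: prod_nonneg)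
    finally show "ennreal (norm (h \<psi>)) \<le> (\<Prod>j<n. ennreal (dom_ker (norm (cis (\<theta> j) - cis (\<psi> j))) (r j))) *
      ennreal (norm (trig_poly n A ?b \<psi>))" .
  qed
  finally show ?thesis .
qed

subsection \<open>Termwise differentiation\<close>

instance complex_hilbert_space \<subseteq> banach ..

text \<open>Convergence at the right endpoint s dominates the differentiated terms on all of {0..s},
  so the Weierstrass test applies. The exponents \<open>k i\<close> may repeat, as they will be one
  coordinate of an enumeration of multi-indices.\<close>

lemma has_vector_derivative_power_series:
  fixes c :: "nat \<Rightarrow> 'b::banach"
  assumes sum: "summable (\<lambda>i. s ^ k i * norm (c i))"
    and sum': "summable (\<lambda>i. real (k i) * s ^ (k i - 1) * norm (c i))"
    and t: "t \<in> {0..s}"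
  shows "((\<lambda>t. \<Sum>i. t ^ k i *\<^sub>R c i) has_vector_derivative
    (\<Sum>i. (real (k i) * t ^ (k i - 1)) *\<^sub>R c i)) (at t within {0..s})"
proof -
  let ?f' = "\<lambda>i x. (real (k i) * x ^ (k i - 1)) *\<^sub>R c i"
  have "uniform_limit {0..s} (\<lambda>n x. \<Sum>i<n. ?f' i x) (\<lambda>x. \<Sum>i. ?f' i x) sequentially"
    by (rule Weierstrass_m_test[OF _ sum'])
      (auto simp: abs_mult intro!: mult_right_mono mult_left_mono power_mono)
  then have U: "\<forall>\<^sub>F n in sequentially. \<forall>x\<in>{0..s}. norm ((\<Sum>i<n. ?f' i x) - (\<Sum>i. ?f' i x)) < e" if "e > 0" for e
    using that by (auto simp: uniform_limit_iff dist_norm)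
  have "\<exists>g. \<forall>x\<in>{0..s}. (\<lambda>i. x ^ k i *\<^sub>R c i) sums (g x) \<and>
      (g has_derivative (\<lambda>h. h *\<^sub>R (\<Sum>i. ?f' i x))) (at x within {0..s})"
  proof (rule has_derivative_series)
    show "((\<lambda>x. x ^ k i *\<^sub>R c i) has_derivative (\<lambda>h. h *\<^sub>R ?f' i x)) (at x within {0..s})" for i x
      by (auto intro!: derivative_eq_intros simp: mult_ac)
    show "\<forall>\<^sub>F n in sequentially. \<forall>x\<in>{0..s}. \<forall>h. norm ((\<Sum>i<n. h *\<^sub>R ?f' i x) - h *\<^sub>R (\<Sum>i. ?f' i x)) \<le> e * norm h"
      if "e > 0" for e
      using U[OF that]
    proof eventually_elim
      case (elim n)
      show ?case
      proof safe
        fix x h :: real assume "x \<in> {0..s}"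
        then have "norm ((\<Sum>i<n. ?f' i x) - (\<Sum>i. ?f' i x)) \<le> e"
          using elim by (auto intro: less_imp_le)
        then have "\<bar>h\<bar> * norm ((\<Sum>i<n. ?f' i x) - (\<Sum>i. ?f' i x)) \<le> \<bar>h\<bar> * e"
          by (rule mult_left_mono) simp
        then show "norm ((\<Sum>i<n. h *\<^sub>R ?f' i x) - h *\<^sub>R (\<Sum>i. ?f' i x)) \<le> e * norm h"
          by (simp only: scaleR_sum_right[symmetric] scaleR_diff_right[symmetric] norm_scaleR real_norm_def mult.commute)
      qed
    qed
    show "s \<in> {0..s}" using t by simp
    have "summable (\<lambda>i. norm (s ^ k i *\<^sub>R c i))"
      using sum t by simp
    then show "(\<lambda>i. s ^ k i *\<^sub>R c i) sums (\<Sum>i. s ^ k i *\<^sub>R c i)"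
      by (rule summable_sums[OF summable_norm_cancel])
  qed simp
  then obtain g where g: "\<And>x. x \<in> {0..s} \<Longrightarrow> (\<lambda>i. x ^ k i *\<^sub>R c i) sums (g x)"
      "\<And>x. x \<in> {0..s} \<Longrightarrow> (g has_vector_derivative (\<Sum>i. ?f' i x)) (at x within {0..s})"
    unfolding has_vector_derivative_def by blast
  show ?thesis
    by (rule has_vector_derivative_transform[OF t _ g(2)[OF t]]) (rule sums_unique[OF g(1), symmetric])
qed

text \<open>Near r j < s the sets {0..<1} and {0..s} coincide, so a derivative found on the compact
  interval is the one in \<open>partial_deriv\<close>; r j is a limit point, which makes it
  unique.\<close>

lemma partial_deriv_eqI:
  assumes "0 \<le> r j" "r j < s" "s < 1"
    and "((\<lambda>t. F (r(j := t))) has_vector_derivative d) (at (r j) within {0..s})"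
  shows "partial_deriv j F r = d"
proof -
  have eq: "at (r j) within {0..<1} = at (r j) within {0..s}"
    by (rule at_within_nhd[where S="{..<s}"]) (use assms in auto)
  have "r j islimpt {0..s}"
    using assms by simp
  then have "at (r j) within {0..<1} \<noteq> bot"
    unfolding eq by (simp add: trivial_limit_within)
  then show ?thesis
    unfolding partial_deriv_def
    by (rule vector_derivative_within) (use assms(4) in \<open>simp add: eq\<close>)
qed

lemma partial_deriv_cong:
  assumes "\<And>t. 0 \<le> t \<Longrightarrow> t < 1 \<Longrightarrow> F (r(j := t)) = G (r(j := t))" "0 \<le> r j" "r j < 1"
  shows "partial_deriv j F r = partial_deriv j G r"
proof -
  have "((\<lambda>t. F (r(j := t))) has_vector_derivative d) (at (r j) within {0..<1}) \<longleftrightarrow>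
      ((\<lambda>t. G (r(j := t))) has_vector_derivative d) (at (r j) within {0..<1})" for d
    by (rule iffI; rule has_vector_derivative_transform[where S="{0..<1}", rotated 2], assumption)
      (simp_all add: assms)
  then show ?thesis
    by (simp add: partial_deriv_def vector_derivative_def)
qed

text \<open>The induction carries agreement on the whole half-open cube, since each
  \<open>partial_deriv\<close> looks along a full coordinate segment, whose points stay in that
  cube.\<close>

lemma mixed_partial_cong:
  assumes "\<And>r. \<forall>j<n. 0 \<le> r j \<and> r j < 1 \<Longrightarrow> F r = G r" "\<forall>j<n. 0 \<le> r j \<and> r j < 1" "m \<le> n"
  shows "mixed_partial m F r = mixed_partial m G r"
  using assms
proof (induction m arbitrary: F G)
  case (Suc m)
  show ?case
    unfolding mixed_partial.simps
  proof (rule Suc.IH)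
    fix r :: "nat \<Rightarrow> real" assume "\<forall>j<n. 0 \<le> r j \<and> r j < 1"
    then show "partial_deriv m F r = partial_deriv m G r"
      using Suc.prems(3) by (intro partial_deriv_cong Suc.prems(1)) auto
  qed (use Suc.prems in auto)
qed simp

section \<open>Enumeration of multi-indices and product series\<close>

lemma countable_multi_indices: "countable (multi_indices n)"
  unfolding multi_indices_def by (rule countable_PiE) auto

lemma infinite_multi_indices:
  assumes "n \<ge> 1"
  shows "infinite (multi_indices n)"
proof
  assume "finite (multi_indices n)"
  then have "finite ((\<lambda>\<alpha>. \<alpha> 0) ` multi_indices n)" by simp
  moreover have "k \<in> (\<lambda>\<alpha>. \<alpha> 0) ` multi_indices n" for k :: nat
    using assms by (intro image_eqI[of _ _ "\<lambda>j\<in>{..<n}. k"]) (auto simp: multi_indices_def)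
  then have "(\<lambda>\<alpha>. \<alpha> 0) ` multi_indices n = UNIV" by blast
  ultimately show False by simp
qed

text \<open>A product of n convergent nonnegative series converges absolutely over the product index
  set, and \<open>e\<close> transports this to an ordinary series.\<close>

lemma summable_multi_indices_prod:
  fixes f :: "nat \<Rightarrow> real"
  assumes e: "bij_betw e UNIV (multi_indices n)" and "summable f" "\<And>k. 0 \<le> f k"
  shows "summable (\<lambda>i. \<Prod>j<n. f (e i j))"
proof -
  have "Infinite_Set_Sum.abs_summable_on f UNIV"
    using assms by (simp add: abs_summable_on_nat_iff')
  then have "Infinite_Set_Sum.abs_summable_on (\<lambda>\<alpha>. \<Prod>j<n. f (\<alpha> j)) (multi_indices n)"
    unfolding multi_indices_def by (intro abs_summable_on_prod_PiE) auto
  then have "Infinite_Set_Sum.abs_summable_on (\<lambda>i. \<Prod>j<n. f (e i j)) UNIV"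
    using abs_summable_on_reindex_bij_betw[OF e, of "\<lambda>\<alpha>. \<Prod>j<n. f (\<alpha> j)"] by simp
  then have "summable (\<lambda>i. norm (\<Prod>j<n. f (e i j)))"
    by (simp add: abs_summable_on_nat_iff')
  then show ?thesis
    by (rule summable_norm_cancel)
qed

section \<open>Monomials under successive differentiation\<close>

lemma summable_majorant:
  assumes "0 \<le> s" "s < 1"
  shows "summable (\<lambda>k. (real k + 1) * s ^ (k - 1))"
proof -
  have "summable (\<lambda>k. real (Suc k) * s ^ k + s ^ k)"
    using assms by (intro summable_add summable_geometric sums_summable[OF geometric_deriv_sums]) auto
  then have "summable (\<lambda>k. (real (Suc k) + 1) * s ^ (Suc k - 1))"
    by (simp add: algebra_simps)
  then show ?thesis
    by (subst (asm) summable_Suc_iff)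
qed

text \<open>The stages of differentiating a monomial: coordinates from m on are already
  differentiated, matching \<open>mixed_partial\<close>, which starts with the highest one. Stage n
  is the monomial, stage 0 its full mixed derivative.\<close>

definition mono_weight :: "nat \<Rightarrow> nat \<Rightarrow> (nat \<Rightarrow> real) \<Rightarrow> (nat \<Rightarrow> nat) \<Rightarrow> real"
  where "mono_weight n m r \<alpha> =
    (\<Prod>j<n. if j < m then r j ^ \<alpha> j else real (\<alpha> j) * r j ^ (\<alpha> j - 1))"

text \<open>A common majorant for both kinds of factor in \<open>mono_weight\<close>, so that a
  single series controls every stage.\<close>

lemma mono_factor_le:
  assumes "0 \<le> t" "t \<le> s" "s \<le> 1"
  shows "t ^ k \<le> (real k + 1) * s ^ (k - 1)" "real k * t ^ (k - 1) \<le> (real k + 1) * s ^ (k - 1)"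
proof -
  have "t ^ k \<le> s ^ k" using assms by (intro power_mono)
  also have "\<dots> \<le> s ^ (k - 1)" using assms by (intro power_decreasing) auto
  also have "\<dots> \<le> (real k + 1) * s ^ (k - 1)"
    using mult_right_mono[of 1 "real k + 1" "s ^ (k - 1)"] assms by simp
  finally show "t ^ k \<le> (real k + 1) * s ^ (k - 1)" .
  show "real k * t ^ (k - 1) \<le> (real k + 1) * s ^ (k - 1)"
    using assms by (intro mult_mono power_mono) auto
qed

lemma mono_weight_bounds:
  assumes "\<And>j. j < n \<Longrightarrow> 0 \<le> r j \<and> r j \<le> s" "s \<le> 1"
  shows "0 \<le> mono_weight n m r \<alpha>"
    and "mono_weight n m r \<alpha> \<le> (\<Prod>j<n. (real (\<alpha> j) + 1) * s ^ (\<alpha> j - 1))"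
  unfolding mono_weight_def
proof -
  have nn: "0 \<le> (if j < m then r j ^ \<alpha> j else real (\<alpha> j) * r j ^ (\<alpha> j - 1))" if "j < n" for j
    using assms(1)[OF that] by simp
  then show "0 \<le> (\<Prod>j<n. if j < m then r j ^ \<alpha> j else real (\<alpha> j) * r j ^ (\<alpha> j - 1))"
    by (intro prod_nonneg) simp
  have "(if j < m then r j ^ \<alpha> j else real (\<alpha> j) * r j ^ (\<alpha> j - 1)) \<le> (real (\<alpha> j) + 1) * s ^ (\<alpha> j - 1)"
    if "j < n" for j
    using mono_factor_le[of "r j" s "\<alpha> j"] assms(1)[OF that] assms(2) by simp
  with nn show "(\<Prod>j<n. if j < m then r j ^ \<alpha> j else real (\<alpha> j) * r j ^ (\<alpha> j - 1))
      \<le> (\<Prod>j<n. (real (\<alpha> j) + 1) * s ^ (\<alpha> j - 1))"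
    by (intro prod_mono) simp
qed

lemma summable_mono_weight:
  assumes e: "bij_betw e UNIV (multi_indices n)"
    and r: "\<And>j. j < n \<Longrightarrow> 0 \<le> r j \<and> r j \<le> s" and s: "0 \<le> s" "s < 1"
    and B: "\<And>i. norm (v i) \<le> B"
  shows "summable (\<lambda>i. mono_weight n m r (e i) * norm (v i))"
proof (rule summable_comparison_test')
  show "summable (\<lambda>i. (\<Prod>j<n. (real (e i j) + 1) * s ^ (e i j - 1)) * B)"
    using s by (intro summable_mult2 summable_multi_indices_prod[OF e, of "\<lambda>k. (real k + 1) * s ^ (k - 1)"] summable_majorant) auto
  fix i :: nat
  show "norm (mono_weight n m r (e i) * norm (v i)) \<le> (\<Prod>j<n. (real (e i j) + 1) * s ^ (e i j - 1)) * B"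
    using mono_weight_bounds[of n r s m "e i"] r s B[of i]
    by (auto simp: abs_mult intro!: mult_mono prod_nonneg)
qed

text \<open>With the other coordinates frozen this is a series of powers of coordinate m, and
  differentiating it lowers the stage of \<open>mono_weight\<close> by one.\<close>

lemma partial_deriv_series:
  fixes v :: "nat \<Rightarrow> 'b::banach"
  assumes e: "bij_betw e UNIV (multi_indices n)" and m: "m < n"
    and r: "\<forall>j<n. 0 \<le> r j \<and> r j < 1"
    and B: "\<And>i. norm (v i) \<le> B"
  shows "partial_deriv m (\<lambda>r. \<Sum>i. mono_weight n (Suc m) r (e i) *\<^sub>R v i) r =
    (\<Sum>i. mono_weight n m r (e i) *\<^sub>R v i)"
proof -
  \<comment> \<open>Midway between the largest coordinate and 1: this leaves room to the right of r
    m while the majorant at s still converges.\<close>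
  define s where "s = (1 + Max (r ` {..<n})) / 2"
  have max: "Max (r ` {..<n}) < 1"
    using m r by (subst Max_less_iff) auto
  have le: "r j \<le> Max (r ` {..<n})" if "j < n" for j
    using that by (intro Max_ge) auto
  have "Max (r ` {..<n}) < s" "s < 1"
    using max by (simp_all add: s_def)
  then have s: "r j < s" "s < 1" if "j < n" for j
    using le_less_trans[OF le[OF that]] by simp_all
  have s01: "0 \<le> s" "s < 1"
    using s[OF m] r m by (auto intro: order_trans less_imp_le)
  \<comment> \<open>The factors other than coordinate m are the same at stages m and m + 1 and do
    not depend on t.\<close>
  define rest where "rest i = (\<Prod>j\<in>{..<n}-{m}. if j < m then r j ^ e i j else real (e i j) * r j ^ (e i j - 1))" for i
  have "(\<Prod>j\<in>{..<n}-{m}. if j < Suc m then (r(m := t)) j ^ e i j else real (e i j) * (r(m := t)) j ^ (e i j - 1))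
      = rest i" for i t
    unfolding rest_def by (intro prod.cong) auto
  then have w1: "mono_weight n (Suc m) (r(m := t)) (e i) = t ^ e i m * rest i" for t i
    unfolding mono_weight_def using m by (subst prod.remove[of _ m]) auto
  have "(\<Prod>j\<in>{..<n}-{m}. if j < m then (r(m := t)) j ^ e i j else real (e i j) * (r(m := t)) j ^ (e i j - 1))
      = rest i" for i t
    unfolding rest_def by (intro prod.cong) auto
  then have w2: "mono_weight n m (r(m := t)) (e i) = real (e i m) * t ^ (e i m - 1) * rest i" for t i
    unfolding mono_weight_def using m by (subst prod.remove[of _ m]) auto
  have rest: "0 \<le> rest i" for i
    unfolding rest_def using r by (intro prod_nonneg) auto
  have rs: "0 \<le> (r(m := s)) j \<and> (r(m := s)) j \<le> s" if "j < n" for j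
    using s[OF that] s01 r that by auto
  have summ: "summable (\<lambda>i. mono_weight n l (r(m := s)) (e i) * norm (v i))" for l
    by (rule summable_mono_weight[OF e rs s01 B])
  have "((\<lambda>t. \<Sum>i. t ^ e i m *\<^sub>R (rest i *\<^sub>R v i)) has_vector_derivative
      (\<Sum>i. (real (e i m) * r m ^ (e i m - 1)) *\<^sub>R (rest i *\<^sub>R v i))) (at (r m) within {0..s})"
  proof (rule has_vector_derivative_power_series)
    show "summable (\<lambda>i. s ^ e i m * norm (rest i *\<^sub>R v i))"
      using summ[of "Suc m"] rest by (simp add: w1 mult.assoc)
    show "summable (\<lambda>i. real (e i m) * s ^ (e i m - 1) * norm (rest i *\<^sub>R v i))"
      using summ[of m] rest by (simp add: w2 mult.assoc)
    show "r m \<in> {0..s}" using r s[OF m] m by auto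
  qed
  then have "((\<lambda>t. \<Sum>i. mono_weight n (Suc m) (r(m := t)) (e i) *\<^sub>R v i) has_vector_derivative
      (\<Sum>i. mono_weight n m (r(m := r m)) (e i) *\<^sub>R v i)) (at (r m) within {0..s})"
    unfolding w1 w2 by simp
  then show ?thesis
    using partial_deriv_eqI[of r m s "\<lambda>r. \<Sum>i. mono_weight n (Suc m) r (e i) *\<^sub>R v i"] r s[OF m] m by simp
qed

lemma mixed_partial_series:
  fixes v :: "nat \<Rightarrow> 'b::banach"
  assumes e: "bij_betw e UNIV (multi_indices n)" and "m \<le> n"
    and r: "\<forall>j<n. 0 \<le> r j \<and> r j < 1"
    and B: "\<And>i. norm (v i) \<le> B"
  shows "mixed_partial m (\<lambda>r. \<Sum>i. mono_weight n m r (e i) *\<^sub>R v i) r =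
    (\<Sum>i. mono_weight n 0 r (e i) *\<^sub>R v i)"
  using assms(2)
proof (induction m)
  case (Suc m)
  have "mixed_partial (Suc m) (\<lambda>r. \<Sum>i. mono_weight n (Suc m) r (e i) *\<^sub>R v i) r =
      mixed_partial m (\<lambda>r. \<Sum>i. mono_weight n m r (e i) *\<^sub>R v i) r"
    unfolding mixed_partial.simps
    by (rule mixed_partial_cong[of n]) (use Suc.prems r partial_deriv_series[OF e _ _ B] in auto)
  then show ?case using Suc by simp
qed simp

lemma dirichlet_space_summable:
  assumes "a \<in> dirichlet_space n" and e: "bij_betw e UNIV (multi_indices n)"
  shows "summable (\<lambda>i. (\<Prod>j<n. real (e i j) + 1) * (norm (a (e i)))\<^sup>2)"
proof -
  have "(\<lambda>i. (\<Prod>j<n. real (e i j) + 1) * (norm (a (e i)))\<^sup>2) summable_on UNIV"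
    using assms summable_on_reindex_bij_betw[OF e, of "\<lambda>\<alpha>. (\<Prod>j<n. real (\<alpha> j) + 1) * (norm (a \<alpha>))\<^sup>2"]
    by (simp add: dirichlet_space_def)
  then show ?thesis
    by (rule summable_on_imp_summable)
qed

text \<open>Every Dirichlet weight is at least 1, so each squared norm is at most the total sum;
  \<open>x \<le> 1 + x^2\<close> then removes the square. Boundedness suffices for convergence
  inside the polydisc.\<close>

lemma dirichlet_space_bounded:
  fixes e :: "nat \<Rightarrow> nat \<Rightarrow> nat"
  assumes "a \<in> dirichlet_space n" and e: "bij_betw e UNIV (multi_indices n)"
  obtains B where "\<And>i. norm (a (e i)) \<le> B"
proof
  fix i
  let ?f = "\<lambda>i. (\<Prod>j<n. real (e i j) + 1) * (norm (a (e i)))\<^sup>2"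
  have "2 * norm (a (e i)) \<le> 1 + (norm (a (e i)))\<^sup>2"
    using sum_squares_bound[of 1 "norm (a (e i))"] by simp
  then have "norm (a (e i)) \<le> 1 + 1 * (norm (a (e i)))\<^sup>2"
    using norm_ge_zero[of "a (e i)"] by linarith
  also have "1 * (norm (a (e i)))\<^sup>2 \<le> ?f i"
    by (intro mult_right_mono prod_ge_1) auto
  also have "?f i \<le> suminf ?f"
    using sum_le_suminf[OF dirichlet_space_summable[OF assms], of "{i}"] by (simp add: prod_nonneg)
  finally show "norm (a (e i)) \<le> 1 + suminf ?f" by simp
qed

lemma mixed_partial_radial_ext:
  fixes a :: "(nat \<Rightarrow> nat) \<Rightarrow> 'h::complex_hilbert_space"
  assumes a: "a \<in> dirichlet_space n" and e: "bij_betw e UNIV (multi_indices n)"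
    and r: "\<forall>j<n. 0 \<le> r j \<and> r j < 1"
  shows "(\<lambda>i. ((\<Prod>j<n. of_real (real (e i j) * r j ^ (e i j - 1))) *
      cis (\<Sum>j<n. real (e i j) * \<theta> j)) *\<^sub>C a (e i)) sums mixed_partial n (radial_ext n a \<theta>) r"
proof -
  define v where "v i = cis (\<Sum>j<n. real (e i j) * \<theta> j) *\<^sub>C a (e i)" for i
  obtain B where "\<And>i. norm (a (e i)) \<le> B"
    using dirichlet_space_bounded[OF a e] by blast
  then have B: "norm (v i) \<le> B" for i
    by (simp add: v_def norm_scaleC)
  have summ: "summable (\<lambda>i. norm (mono_weight n m r (e i) *\<^sub>R v i))"
    if r: "\<forall>j<n. 0 \<le> r j \<and> r j < 1" for m r
  proof (cases "n = 0")
    case True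
    \<comment> \<open>For n = 0 there is one multi-index only, so \<open>e\<close> cannot be
      injective on the naturals.\<close>
    have "inj e" "range e = {\<lambda>_. undefined}"
      using e True by (auto simp: bij_betw_def multi_indices_def)
    then show ?thesis
      using finite_imageD[of e UNIV] by simp
  next
    case False
    have M: "Max (r ` {..<n}) < 1" "\<And>j. j < n \<Longrightarrow> r j \<le> Max (r ` {..<n})"
      using False r by (subst Max_less_iff) auto
    then have "0 \<le> Max (r ` {..<n})"
      using False r M(2)[of 0] by (auto intro: order_trans[of 0 "r 0"])
    with M have "summable (\<lambda>i. mono_weight n m r (e i) * norm (v i))"
      using r by (intro summable_mono_weight[OF e _ _ _ B, of r "Max (r ` {..<n})"]) auto
    then show ?thesis
      using mono_weight_bounds(1)[of n r 1] r by (simp add: less_imp_le)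
  qed
  have ext: "radial_ext n a \<theta> r = (\<Sum>i. mono_weight n n r (e i) *\<^sub>R v i)"
    if r: "\<forall>j<n. 0 \<le> r j \<and> r j < 1" for r
  proof -
    \<comment> \<open>\<open>radial_ext\<close> is an unordered sum; absolute convergence identifies
      it with the series along \<open>e\<close>.\<close>
    have "((\<lambda>i. mono_weight n n r (e i) *\<^sub>R v i) has_sum (\<Sum>i. mono_weight n n r (e i) *\<^sub>R v i)) UNIV"
      by (rule norm_summable_imp_has_sum[OF summ[OF r]])
        (rule summable_sums[OF summable_norm_cancel[OF summ[OF r]]])
    then have inf: "infsum (\<lambda>i. mono_weight n n r (e i) *\<^sub>R v i) UNIV = (\<Sum>i. mono_weight n n r (e i) *\<^sub>R v i)"
      by (rule infsumI)
    have "mono_weight n n r (e i) = (\<Prod>j<n. r j ^ e i j)" for i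
      unfolding mono_weight_def by (rule prod.cong) auto
    then have term_eq: "(complex_of_real (\<Prod>j<n. r j ^ e i j) * cis (\<Sum>j<n. real (e i j) * \<theta> j)) *\<^sub>C a (e i) =
        mono_weight n n r (e i) *\<^sub>R v i" for i
      by (simp only: v_def scaleR_eq_scaleC scaleC_scaleC)
    show ?thesis
      unfolding radial_ext_def infsum_reindex_bij_betw[OF e, symmetric] term_eq inf ..
  qed
  have "mixed_partial n (radial_ext n a \<theta>) r = mixed_partial n (\<lambda>r. \<Sum>i. mono_weight n n r (e i) *\<^sub>R v i) r"
    by (rule mixed_partial_cong[of n]) (use ext r in auto)
  also have "\<dots> = (\<Sum>i. mono_weight n 0 r (e i) *\<^sub>R v i)"
    by (rule mixed_partial_series[OF e _ r B]) simp
  finally have "(\<lambda>i. mono_weight n 0 r (e i) *\<^sub>R v i) sums mixed_partial n (radial_ext n a \<theta>) r"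
    using summable_sums[OF summable_norm_cancel[OF summ[OF r, of 0]]] by simp
  moreover have "mono_weight n 0 r (e i) *\<^sub>R v i = ((\<Prod>j<n. of_real (real (e i j) * r j ^ (e i j - 1))) *
      cis (\<Sum>j<n. real (e i j) * \<theta> j)) *\<^sub>C a (e i)" for i
    by (simp only: v_def mono_weight_def scaleR_eq_scaleC scaleC_scaleC not_less_zero if_False of_real_prod)
  ultimately show ?thesis by (simp only:)
qed

subsection \<open>Domination by a potential\<close>

text \<open>Cut points come from the Cauchy criterion. The ratio 1/4 leaves a convergent geometric
  series after the weight 2^k of \<open>suminf_square_le\<close> is spent.\<close>

lemma summable_blocks:
  fixes w :: "nat \<Rightarrow> real"
  assumes w: "summable w" "\<And>i. 0 \<le> w i"
  obtains N C where "N 0 = 0" "strict_mono N" "0 \<le> C"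
    "\<And>k. (\<Sum>i\<in>{N k..<N (Suc k)}. w i) \<le> C * (1/4) ^ k"
proof -
  \<comment> \<open>The added 1 keeps C positive even if w vanishes, as the Cauchy criterion
    requires a positive tolerance.\<close>
  define C where "C = 1 + suminf w"
  have C: "C > 0" "suminf w \<le> C"
    using suminf_nonneg[OF w] by (auto simp: C_def)
  \<comment> \<open>The bound concerns all finite sums that start at or after x, so it holds
    wherever the next cut falls. At k = 0 the total sum is bound enough, which permits the cut
    0.\<close>
  define P where "P k x \<longleftrightarrow> (\<forall>m\<ge>x. \<forall>n. (\<Sum>i\<in>{m..<n}. w i) \<le> C * (1/4) ^ k) \<and> (k = 0 \<longrightarrow> x = 0)" for k x :: nat
  have ex: "\<exists>N. \<forall>k. P k (N k) \<and> N k < N (Suc k)"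
  proof (rule dependent_nat_choice)
    have "(\<Sum>i\<in>{m..<n}. w i) \<le> C" for m n
      using sum_le_suminf[OF w(1), of "{m..<n}"] w(2) C by auto
    then show "\<exists>x. P 0 x" by (auto simp: P_def)
    fix x k
    have "C * (1/4) ^ Suc k > 0" using C by simp
    then obtain N where "\<forall>m\<ge>N. \<forall>n. norm (\<Sum>i\<in>{m..<n}. w i) < C * (1/4) ^ Suc k"
      using w(1) unfolding summable_Cauchy by blast
    then have "\<forall>m\<ge>max N (Suc x). \<forall>n. (\<Sum>i\<in>{m..<n}. w i) \<le> C * (1/4) ^ Suc k"
      by (auto simp: less_imp_le w(2) sum_nonneg)
    then show "\<exists>y. P (Suc k) y \<and> x < y"
      by (intro exI[of _ "max N (Suc x)"]) (auto simp: P_def)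
  qed
  then obtain N where N: "\<And>k. P k (N k)" "\<And>k. N k < N (Suc k)" by blast
  show thesis
  proof (rule that)
    show "N 0 = 0" using N(1)[of 0] by (simp add: P_def)
    show "strict_mono N" using N(2) by (simp add: strict_mono_Suc_iff)
    show "0 \<le> C" using C by simp
    show "(\<Sum>i\<in>{N k..<N (Suc k)}. w i) \<le> C * (1/4) ^ k" for k
      using N(1)[of k] by (simp add: P_def)
  qed
qed

text \<open>Along the cut points the partial sums consist of whole blocks, and the triangle
  inequality passes to the limit; the right-hand side may be infinite.\<close>

lemma norm_le_suminf_blocks:
  fixes f :: "nat \<Rightarrow> 'b::real_normed_vector"
  assumes "f sums S" and N: "N 0 = 0" "strict_mono N"
  shows "ennreal (norm S) \<le> (\<Sum>k. ennreal (norm (\<Sum>i\<in>{N k..<N (Suc k)}. f i)))"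
proof (rule LIMSEQ_le_const2)
  have "(\<lambda>n. \<Sum>i<n. f i) \<longlonglongrightarrow> S"
    using assms(1) by (simp add: sums_def)
  then have "(\<lambda>K. \<Sum>i<N K. f i) \<longlonglongrightarrow> S"
    using LIMSEQ_subseq_LIMSEQ[OF _ N(2)] by (force simp: o_def)
  then show "(\<lambda>K. ennreal (norm (\<Sum>i<N K. f i))) \<longlonglongrightarrow> ennreal (norm S)"
    by (intro tendsto_ennrealI tendsto_norm)
  have split: "(\<Sum>i<N K. f i) = (\<Sum>k<K. \<Sum>i\<in>{N k..<N (Suc k)}. f i)" for K
  proof (induction K)
    case (Suc K)
    have "N K \<le> N (Suc K)" using N(2) by (simp add: strict_mono_less_eq)
    then have "(\<Sum>i<N (Suc K). f i) = (\<Sum>i<N K. f i) + (\<Sum>i\<in>{N K..<N (Suc K)}. f i)"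
      by (subst sum.union_disjoint[symmetric]) (auto simp: ivl_disj_un)
    then show ?case using Suc by simp
  qed (simp add: N)
  have "ennreal (norm (\<Sum>i<N K. f i)) \<le> (\<Sum>k. ennreal (norm (\<Sum>i\<in>{N k..<N (Suc k)}. f i)))" for K
  proof -
    have "ennreal (norm (\<Sum>i<N K. f i)) \<le> ennreal (\<Sum>k<K. norm (\<Sum>i\<in>{N k..<N (Suc k)}. f i))"
      unfolding split by (intro ennreal_leI norm_sum)
    also have "\<dots> = (\<Sum>k<K. ennreal (norm (\<Sum>i\<in>{N k..<N (Suc k)}. f i)))"
      by simp
    also have "\<dots> \<le> (\<Sum>k. ennreal (norm (\<Sum>i\<in>{N k..<N (Suc k)}. f i)))"
      by (intro sum_le_suminf) auto
    finally show ?thesis .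
  qed
  then show "\<exists>K0. \<forall>K\<ge>K0. ennreal (norm (\<Sum>i<N K. f i)) \<le> (\<Sum>k. ennreal (norm (\<Sum>i\<in>{N k..<N (Suc k)}. f i)))"
    by blast
qed

text \<open>Cauchy-Schwarz with weights 2^k and 2^(-k), the latter summing to 2. Bounding the double
  sum termwise by AM-GM also covers divergent series.\<close>

lemma suminf_square_le:
  fixes x :: "nat \<Rightarrow> real"
  assumes x: "\<And>k. 0 \<le> x k"
  shows "(\<Sum>k. ennreal (x k))\<^sup>2 \<le> 2 * (\<Sum>k. ennreal (2 ^ k * (x k)\<^sup>2))"
proof -
  let ?H = "\<Sum>k. ennreal (2 ^ k * (x k)\<^sup>2)"
  have half: "(\<Sum>k. ennreal ((1/2) ^ Suc k)) = 1"
  proof -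
    have "(\<lambda>k. (1/2) ^ Suc k) sums (1::real)"
      using power_half_series by simp
    then show ?thesis by (subst suminf_ennreal_eq) auto
  qed
  have amgm: "x k * x l \<le> (2 ^ k * (x k)\<^sup>2) * (1/2) ^ Suc l + (1/2) ^ Suc k * (2 ^ l * (x l)\<^sup>2)" for k l
  proof -
    \<comment> \<open>Expanding and dividing by 2 * 2^k * 2^l gives the claim; the extra 2 produces
      the exponents \<open>Suc l\<close> and \<open>Suc k\<close>, for which the geometric sum is
      1.\<close>
    have "0 \<le> (2 ^ k * x k - 2 ^ l * x l)\<^sup>2" by simp
    then have "2 * (2 ^ k * 2 ^ l) * (x k * x l) \<le> (2 ^ k)\<^sup>2 * (x k)\<^sup>2 + (2 ^ l)\<^sup>2 * (x l)\<^sup>2"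
      by (simp add: power2_diff power_mult_distrib mult_ac)
    then show ?thesis
      by (simp add: power_divide divide_simps power2_eq_square) (simp add: mult_ac)
  qed
  have "(\<Sum>k. ennreal (x k))\<^sup>2 = (\<Sum>k. \<Sum>l. ennreal (x k) * ennreal (x l))"
    by (simp add: power2_eq_square)
  also have "\<dots> \<le> (\<Sum>k. \<Sum>l. ennreal (2 ^ k * (x k)\<^sup>2) * ennreal ((1/2) ^ Suc l) +
      ennreal ((1/2) ^ Suc k) * ennreal (2 ^ l * (x l)\<^sup>2))"
    using amgm x by (intro suminf_le summableI)
      (simp add: ennreal_mult[symmetric] ennreal_plus[symmetric] del: ennreal_plus power_Suc)
  also have "\<dots> = ?H + ?H"
    by (simp only: suminf_add[symmetric, OF summableI summableI] ennreal_suminf_cmult ennreal_suminf_multc half mult_1 mult_1_right)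
  also have "\<dots> = 2 * ?H"
    by (simp add: mult_2)
  finally show ?thesis .
qed

section \<open>Capacity of sets on which a potential is infinite\<close>

lemma capacity_eq_0I:
  assumes G [measurable]: "G \<in> borel_measurable (torus_measure n)"
    and fin: "(\<integral>\<^sup>+\<psi>. (G \<psi>)\<^sup>2 \<partial>torus_measure n) < \<infinity>"
    and E: "\<And>\<theta>. \<theta> \<in> E \<Longrightarrow> potential n G \<theta> = \<infinity>"
  shows "capacity n E = 0"
proof -
  let ?A = "\<integral>\<^sup>+\<psi>. (G \<psi>)\<^sup>2 \<partial>torus_measure n"
  have "cis \<in> borel_measurable borel"
    by (intro borel_measurable_continuous_onI continuous_intros)
  note [measurable] = this
  have le: "capacity n E \<le> (ennreal (1 / Suc i))\<^sup>2 * ?A" for i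
  proof -
    let ?c = "ennreal (1 / Suc i)"
    have "potential n (\<lambda>\<psi>. ?c * G \<psi>) \<theta> \<ge> 1" if "\<theta> \<in> E" for \<theta>
    proof -
      have "potential n (\<lambda>\<psi>. ?c * G \<psi>) \<theta> = ?c * potential n G \<theta>"
        unfolding potential_def
        by (subst nn_integral_cmult[symmetric]) (auto simp: mult_ac intro!: borel_measurable_times_ennreal borel_measurable_prod_ennreal)
      then show ?thesis
        using E[OF that] by (simp add: ennreal_mult_top)
    qed
    then have "capacity n E \<le> (\<integral>\<^sup>+\<psi>. (?c * G \<psi>)\<^sup>2 \<partial>torus_measure n)"
      unfolding capacity_def by (intro INF_lower) auto
    also have "\<dots> = ?c\<^sup>2 * ?A"
      by (simp add: power_mult_distrib nn_integral_cmult)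
    finally show ?thesis .
  qed
  obtain A where A: "?A = ennreal A" "0 \<le> A"
    using fin by (cases ?A) auto
  have "(\<lambda>i. (1 / real (Suc i))\<^sup>2 * A) \<longlonglongrightarrow> 0\<^sup>2 * A"
    by (intro tendsto_intros LIMSEQ_Suc[OF lim_const_over_n, of 1])
  then have "(\<lambda>i. ennreal ((1 / real (Suc i))\<^sup>2 * A)) \<longlonglongrightarrow> 0"
    using tendsto_ennrealI by fastforce
  then have "capacity n E \<le> 0"
    using le A by (intro LIMSEQ_le_const) (auto simp: ennreal_mult ennreal_power simp del: of_nat_Suc)
  then show ?thesis by simp
qed

section \<open>Integrating the kernel over the cube\<close>

interpretation lborel_product: product_sigma_finite "\<lambda>_::nat. lborel :: real measure"
  by unfold_locales

lemma AE_PiM_lborel_neq: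
  "AE r in PiM {..<n} (\<lambda>_::nat. lborel :: real measure). \<forall>j<n. r j \<noteq> c"
proof -
  have "AE r in PiM {..<n} (\<lambda>_::nat. lborel :: real measure). r j \<noteq> c" if j: "j < n" for j
  proof (rule AE_I')
    let ?A = "\<lambda>i. if i = j then {c} else UNIV :: real set"
    have "emeasure (PiM {..<n} (\<lambda>_. lborel)) (PiE {..<n} ?A) = (\<Prod>i<n. emeasure lborel (?A i))"
      by (rule lborel_product.emeasure_PiM) auto
    \<comment> \<open>The other sides have infinite length, but 0 * \<infinity> = 0 in
      \<open>ennreal\<close>.\<close>
    also have "\<dots> = 0"
      using j by (intro prod_zero) auto
    finally show "PiE {..<n} ?A \<in> null_sets (PiM {..<n} (\<lambda>_. lborel))"
      by (auto intro!: null_setsI sets_PiM_I_finite)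
    show "{r \<in> space (PiM {..<n} (\<lambda>_. lborel)). \<not> r j \<noteq> c} \<subseteq> PiE {..<n} ?A"
      by (fastforce simp: space_PiM PiE_iff extensional_def)
  qed
  then have "AE r in PiM {..<n} (\<lambda>_::nat. lborel :: real measure). \<forall>j\<in>{..<n}. r j \<noteq> c"
    by (intro AE_finite_allI) auto
  then show ?thesis
    by eventually_elim simp
qed

lemma radial_kernel_le_potential:
  assumes G [measurable]: "G \<in> borel_measurable (torus_measure n)"
  shows "(\<integral>\<^sup>+r\<in>({..<n} \<rightarrow>\<^sub>E {0..1}).
      (\<integral>\<^sup>+\<psi>. (\<Prod>j<n. ennreal (dom_ker (norm (cis (\<theta> j) - cis (\<psi> j))) (r j))) * G \<psi> \<partial>torus_measure n)
      \<partial>(PiM {..<n} (\<lambda>_. lborel))) \<le> 8 ^ n * potential n G \<theta>"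
    (is "?L \<le> _")
proof -
  let ?M = "PiM {..<n} (\<lambda>_::nat. lborel :: real measure)" and ?T = "torus_measure n"
  \<comment> \<open>Distributing the indicator of the cube over the coordinates makes the whole
    integrand a product of one-variable factors.\<close>
  define h where "h j r y = ennreal (dom_ker (norm (cis (\<theta> j) - cis y)) r) * indicator {0..1} r"
    for j and r y :: real
  have "sigma_finite_measure ?M"
    by (rule lborel_product.sigma_finite) simp
  moreover have "sigma_finite_measure ?T"
    by (intro prob_space_imp_sigma_finite prob_space_torus_measure)
  ultimately interpret pair_sigma_finite ?M ?T
    by (simp add: pair_sigma_finite_def)
  have "cis \<in> borel_measurable borel"
    by (intro borel_measurable_continuous_onI continuous_intros)
  note [measurable] = this
  have h [measurable]: "(\<lambda>x. h j (f x) (g x)) \<in> borel_measurable M"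
    if [measurable]: "f \<in> borel_measurable M" "g \<in> borel_measurable M" for j f g and M :: "'c measure"
    unfolding h_def dom_ker_def by measurable
  have comp: "(\<lambda>x. fst x j) \<in> borel_measurable (?M \<Otimes>\<^sub>M ?T)" "(\<lambda>x. snd x j) \<in> borel_measurable (?M \<Otimes>\<^sub>M ?T)"
    if "j < n" for j
    using that
    by (auto intro: measurable_compose[OF measurable_fst measurable_component_singleton[of j "{..<n}" "\<lambda>_. lborel", simplified]]
      measurable_compose[OF measurable_snd measurable_torus_component])
  have ind: "indicator ({..<n} \<rightarrow>\<^sub>E {0..1}) r = (\<Prod>j<n. indicator {0..1} (r j) :: ennreal)"
    if "r \<in> space ?M" for r
    using that by (auto simp: space_PiM PiE_iff indicator_def prod_zero_iff)
  have "?L = (\<integral>\<^sup>+r. (\<integral>\<^sup>+\<psi>. (\<Prod>j<n. h j (r j) (\<psi> j)) * G \<psi> \<partial>?T) \<partial>?M)"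
  proof (rule nn_integral_cong)
    fix r assume r: "r \<in> space ?M"
    have "(\<integral>\<^sup>+\<psi>. (\<Prod>j<n. ennreal (dom_ker (norm (cis (\<theta> j) - cis (\<psi> j))) (r j))) * G \<psi> \<partial>?T) *
        indicator ({..<n} \<rightarrow>\<^sub>E {0..1}) r =
      (\<integral>\<^sup>+\<psi>. (\<Prod>j<n. ennreal (dom_ker (norm (cis (\<theta> j) - cis (\<psi> j))) (r j))) * G \<psi> *
        indicator ({..<n} \<rightarrow>\<^sub>E {0..1}) r \<partial>?T)"
      by (subst nn_integral_multc)
        (auto simp: dom_ker_def intro!: borel_measurable_times_ennreal borel_measurable_prod_ennreal)
    also have "\<dots> = (\<integral>\<^sup>+\<psi>. (\<Prod>j<n. h j (r j) (\<psi> j)) * G \<psi> \<partial>?T)"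
      unfolding ind[OF r] h_def prod.distrib by (simp add: mult_ac)
    finally show "(\<integral>\<^sup>+\<psi>. (\<Prod>j<n. ennreal (dom_ker (norm (cis (\<theta> j) - cis (\<psi> j))) (r j))) * G \<psi> \<partial>?T) *
        indicator ({..<n} \<rightarrow>\<^sub>E {0..1}) r = (\<integral>\<^sup>+\<psi>. (\<Prod>j<n. h j (r j) (\<psi> j)) * G \<psi> \<partial>?T)" .
  qed
  \<comment> \<open>Tonelli: with \<psi> outside, the inner integral splits into one-dimensional
    ones, each bounded by 8 times a factor of the capacity kernel.\<close>
  also have "\<dots> = (\<integral>\<^sup>+\<psi>. (\<integral>\<^sup>+r. (\<Prod>j<n. h j (r j) (\<psi> j)) * G \<psi> \<partial>?M) \<partial>?T)"
    by (rule Fubini'[symmetric])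
      (auto simp: case_prod_beta' intro!: borel_measurable_times_ennreal borel_measurable_prod_ennreal h comp
        measurable_compose[OF measurable_snd G])
  also have "\<dots> \<le> (\<integral>\<^sup>+\<psi>. 8 ^ n * ((\<Prod>j<n. 1 / ennreal (norm (cis (\<theta> j) - cis (\<psi> j)) powr (1/2))) * G \<psi>) \<partial>?T)"
  proof (rule nn_integral_mono)
    fix \<psi>
    have "(\<integral>\<^sup>+r. (\<Prod>j<n. h j (r j) (\<psi> j)) * G \<psi> \<partial>?M) = (\<integral>\<^sup>+r. (\<Prod>j<n. h j (r j) (\<psi> j)) \<partial>?M) * G \<psi>"
      by (rule nn_integral_multc) (intro borel_measurable_prod_ennreal h borel_measurable_const
        measurable_component_singleton[where M="\<lambda>_. lborel", simplified], simp)
    also have "(\<integral>\<^sup>+r. (\<Prod>j<n. h j (r j) (\<psi> j)) \<partial>?M) = (\<Prod>j<n. \<integral>\<^sup>+r. h j r (\<psi> j) \<partial>lborel)"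
      by (rule lborel_product.product_nn_integral_prod) auto
    also have "\<dots> \<le> (\<Prod>j<n. 8 * (1 / ennreal (norm (cis (\<theta> j) - cis (\<psi> j)) powr (1/2))))"
      using nn_integral_dom_ker_le by (intro prod_mono_ennreal) (auto simp: h_def)
    also have "\<dots> = 8 ^ n * (\<Prod>j<n. 1 / ennreal (norm (cis (\<theta> j) - cis (\<psi> j)) powr (1/2)))"
      by (simp add: prod.distrib)
    finally show "(\<integral>\<^sup>+r. (\<Prod>j<n. h j (r j) (\<psi> j)) * G \<psi> \<partial>?M) \<le>
        8 ^ n * ((\<Prod>j<n. 1 / ennreal (norm (cis (\<theta> j) - cis (\<psi> j)) powr (1/2))) * G \<psi>)"
      by (simp add: mult_right_mono mult.assoc)
  qed
  also have "\<dots> = 8 ^ n * potential n G \<theta>"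
    unfolding potential_def
    by (rule nn_integral_cmult) (auto intro!: borel_measurable_times_ennreal borel_measurable_prod_ennreal)
  finally show ?thesis .
qed

section \<open>Construction of the dominating function\<close>

lemma radial_variation_le_potential:
  fixes a :: "(nat \<Rightarrow> nat) \<Rightarrow> 'h::complex_hilbert_space"
  assumes n: "n \<ge> 1" and a: "a \<in> dirichlet_space n"
  obtains G where "G \<in> borel_measurable (torus_measure n)"
    "(\<integral>\<^sup>+\<psi>. (G \<psi>)\<^sup>2 \<partial>torus_measure n) < \<infinity>"
    "\<And>\<theta>. radial_variation n a \<theta> \<le> 8 ^ n * potential n G \<theta>"
proof -
  let ?M = "PiM {..<n} (\<lambda>_::nat. lborel :: real measure)" and ?T = "torus_measure n"
  \<comment> \<open>As n \<ge> 1, the index set is infinite and all naturals can be used for its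
    enumeration.\<close>
  obtain e where e: "bij_betw e (UNIV :: nat set) (multi_indices n)"
    using bij_betw_from_nat_into[OF countable_multi_indices infinite_multi_indices[OF n]] by blast
  define w where "w i = (\<Prod>j<n. real (e i j) + 1) * (norm (a (e i)))\<^sup>2" for i
  have w: "summable w" "0 \<le> w i" for i
    using dirichlet_space_summable[OF a e] by (auto simp: w_def[abs_def] prod_nonneg)
  obtain N C where N: "N 0 = 0" "strict_mono N" and C: "0 \<le> C"
    and blocks: "\<And>k. (\<Sum>i\<in>{N k..<N (Suc k)}. w i) \<le> C * (1/4) ^ k"
    using summable_blocks[OF w] by blast
  define D where "D k = e ` {N k..<N (Suc k)}" for k
  have D: "D k \<subseteq> multi_indices n" for k
    using e by (auto simp: D_def bij_betw_def)
  have sum_D: "sum g (D k) = (\<Sum>i\<in>{N k..<N (Suc k)}. g (e i))" for g :: "_ \<Rightarrow> 'c::comm_monoid_add" and k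
    unfolding D_def using e by (subst sum.reindex) (auto simp: bij_betw_def intro: inj_on_subset)
  define b where "b \<alpha> = of_real (\<Prod>j<n. mult_coef (\<alpha> j)) *\<^sub>C a \<alpha>" for \<alpha>
  define x where "x k \<psi> = norm (trig_poly n (D k) b \<psi>)" for k \<psi>
  \<comment> \<open>Only norms of block polynomials enter, so one function serves all r and
    \<theta>.\<close>
  define G where "G \<psi> = (\<Sum>k. ennreal (x k \<psi>))" for \<psi>
  have x [measurable]: "x k \<in> borel_measurable ?T" for k
    unfolding x_def by measurable
  have G [measurable]: "G \<in> borel_measurable ?T"
    unfolding G_def by measurable
  have norm_b: "(norm (b \<alpha>))\<^sup>2 \<le> (\<Prod>j<n. real (\<alpha> j) + 1) * (norm (a \<alpha>))\<^sup>2" for \<alpha>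
  proof -
    have "(\<Prod>j<n. mult_coef (\<alpha> j))\<^sup>2 \<le> (\<Prod>j<n. real (\<alpha> j) + 1)"
      unfolding prod_power_distrib by (intro prod_mono) (auto simp: mult_coef_square_le)
    then show ?thesis
      by (simp only: b_def norm_scaleC power_mult_distrib norm_of_real power2_abs) (rule mult_right_mono, auto)
  qed
  \<comment> \<open>Parseval and \<open>norm_b\<close> bound the squared norm of block k by C / 4^k,
    which beats the weight 2^k.\<close>
  have x_L2: "(\<integral>\<^sup>+\<psi>. ennreal (2 ^ k * (x k \<psi>)\<^sup>2) \<partial>?T) \<le> ennreal (C * (1/2) ^ k)" for k
  proof -
    have "(\<integral>\<^sup>+\<psi>. ennreal (2 ^ k * (x k \<psi>)\<^sup>2) \<partial>?T) = ennreal (2 ^ k) * (\<integral>\<^sup>+\<psi>. (ennreal (x k \<psi>))\<^sup>2 \<partial>?T)"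
      by (subst nn_integral_cmult[symmetric]) (auto simp: ennreal_mult ennreal_power x_def)
    also have "\<dots> = ennreal (2 ^ k) * ennreal (\<Sum>\<alpha>\<in>D k. (norm (b \<alpha>))\<^sup>2)"
      unfolding x_def by (subst nn_integral_trig_poly[OF D]) simp
    also have "\<dots> \<le> ennreal (2 ^ k) * ennreal (C * (1/4) ^ k)"
    proof (intro mult_left_mono ennreal_leI)
      have "(\<Sum>\<alpha>\<in>D k. (norm (b \<alpha>))\<^sup>2) \<le> (\<Sum>\<alpha>\<in>D k. (\<Prod>j<n. real (\<alpha> j) + 1) * (norm (a \<alpha>))\<^sup>2)"
        by (intro sum_mono norm_b)
      also have "\<dots> \<le> C * (1/4) ^ k"
        using blocks[of k] unfolding sum_D w_def .
      finally show "(\<Sum>\<alpha>\<in>D k. (norm (b \<alpha>))\<^sup>2) \<le> C * (1/4) ^ k" .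
    qed simp
    also have "\<dots> = ennreal (2 ^ k * (C * (1/4) ^ k))"
      using C by (simp add: ennreal_mult)
    also have "2 ^ k * (C * (1/4) ^ k) = C * (1/2) ^ k"
    proof -
      have "(2::real) ^ k * (1/4) ^ k = (1/2) ^ k"
        by (simp flip: power_mult_distrib)
      then show ?thesis by (simp add: mult_ac)
    qed
    finally show ?thesis .
  qed
  show thesis
  proof (rule that[OF G])
    have "(\<integral>\<^sup>+\<psi>. (G \<psi>)\<^sup>2 \<partial>?T) \<le> (\<integral>\<^sup>+\<psi>. 2 * (\<Sum>k. ennreal (2 ^ k * (x k \<psi>)\<^sup>2)) \<partial>?T)"
      unfolding G_def by (intro nn_integral_mono suminf_square_le) (simp add: x_def)
    also have "\<dots> = 2 * (\<Sum>k. \<integral>\<^sup>+\<psi>. ennreal (2 ^ k * (x k \<psi>)\<^sup>2) \<partial>?T)"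
      by (subst nn_integral_cmult, measurable) (subst nn_integral_suminf, auto)
    also have "\<dots> \<le> 2 * (\<Sum>k. ennreal (C * (1/2) ^ k))"
      by (intro mult_left_mono suminf_le x_L2 summableI) auto
    also have "\<dots> = 2 * ennreal (\<Sum>k. C * (1/2) ^ k)"
      using C by (subst suminf_ennreal2) (auto intro!: summable_mult summable_geometric)
    also have "\<dots> < \<infinity>"
      by (simp add: ennreal_mult_less_top)
    finally show "(\<integral>\<^sup>+\<psi>. (G \<psi>)\<^sup>2 \<partial>?T) < \<infinity>" .
    fix \<theta> :: "nat \<Rightarrow> real"
    let ?K = "\<lambda>r \<psi>. \<Prod>j<n. ennreal (dom_ker (norm (cis (\<theta> j) - cis (\<psi> j))) (r j))"
    have "cis \<in> borel_measurable borel"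
      by (intro borel_measurable_continuous_onI continuous_intros)
    note [measurable] = this
    have K [measurable]: "?K r \<in> borel_measurable ?T" for r
      unfolding dom_ker_def by (intro borel_measurable_prod_ennreal) auto
    \<comment> \<open>Each block is bounded by the convolution with its own polynomial; summing
      under the integral assembles \<open>G\<close>.\<close>
    have pw: "ennreal (norm (mixed_partial n (radial_ext n a \<theta>) r)) \<le> (\<integral>\<^sup>+\<psi>. ?K r \<psi> * G \<psi> \<partial>?T)"
      if r: "\<forall>j<n. 0 \<le> r j \<and> r j < 1" for r
    proof -
      let ?t = "\<lambda>\<alpha>. ((\<Prod>j<n. of_real (real (\<alpha> j) * r j ^ (\<alpha> j - 1))) *
        cis (\<Sum>j<n. real (\<alpha> j) * \<theta> j)) *\<^sub>C a \<alpha>"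
      have "ennreal (norm (mixed_partial n (radial_ext n a \<theta>) r)) \<le> (\<Sum>k. ennreal (norm (\<Sum>\<alpha>\<in>D k. ?t \<alpha>)))"
        unfolding sum_D by (rule norm_le_suminf_blocks[OF mixed_partial_radial_ext[OF a e r] N])
      also have "\<dots> \<le> (\<Sum>k. \<integral>\<^sup>+\<psi>. ?K r \<psi> * ennreal (x k \<psi>) \<partial>?T)"
        unfolding x_def b_def by (intro suminf_le summableI norm_block_le) (use r in auto)
      also have "\<dots> = (\<integral>\<^sup>+\<psi>. ?K r \<psi> * G \<psi> \<partial>?T)"
        unfolding G_def by (subst nn_integral_suminf[symmetric]) auto
      finally show ?thesis .
    qed
    have "radial_variation n a \<theta> \<le> (\<integral>\<^sup>+r\<in>({..<n} \<rightarrow>\<^sub>E {0..1}). (\<integral>\<^sup>+\<psi>. ?K r \<psi> * G \<psi> \<partial>?T) \<partial>?M)"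
      unfolding radial_variation_def
    \<comment> \<open>The pointwise bound holds for r in [0,1)^n only; the faces where a coordinate
      equals 1 are discarded as null sets.\<close>
    proof (rule nn_integral_mono_AE)
      show "AE r in ?M. ennreal (norm (mixed_partial n (radial_ext n a \<theta>) r)) * indicator ({..<n} \<rightarrow>\<^sub>E {0..1}) r
          \<le> (\<integral>\<^sup>+\<psi>. ?K r \<psi> * G \<psi> \<partial>?T) * indicator ({..<n} \<rightarrow>\<^sub>E {0..1}) r"
        using AE_PiM_lborel_neq[of n 1]
      proof eventually_elim
        case (elim r)
        show ?case
        proof (cases "r \<in> {..<n} \<rightarrow>\<^sub>E {0..1}")
          case True
          then have "\<forall>j<n. 0 \<le> r j \<and> r j < 1"
            using elim by (auto simp: PiE_iff less_le)
          from pw[OF this] show ?thesis by (rule mult_right_mono) simp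
        qed simp
      qed
    qed
    also have "\<dots> \<le> 8 ^ n * potential n G \<theta>"
      by (rule radial_kernel_le_potential[OF G])
    finally show "radial_variation n a \<theta> \<le> 8 ^ n * potential n G \<theta>" .
  qed
qed

theorem theorem3:
  fixes n :: nat and a :: "(nat \<Rightarrow> nat) \<Rightarrow> 'h::complex_hilbert_space"
  assumes "n \<ge> 1" and "a \<in> dirichlet_space n"
  shows "quasi_everywhere n (\<lambda>\<theta>. radial_variation n a \<theta> < \<infinity>)"
proof -
  obtain G where G: "G \<in> borel_measurable (torus_measure n)"
    "(\<integral>\<^sup>+\<psi>. (G \<psi>)\<^sup>2 \<partial>torus_measure n) < \<infinity>"
    "\<And>\<theta>. radial_variation n a \<theta> \<le> 8 ^ n * potential n G \<theta>"
    using radial_variation_le_potential[OF assms] by blast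
  let ?E = "{\<theta> \<in> space (torus_measure n). radial_variation n a \<theta> = \<infinity>}"
  \<comment> \<open>The factor 8^n is finite, so an infinite variation forces an infinite
    potential.\<close>
  have "potential n G \<theta> = \<infinity>" if "\<theta> \<in> ?E" for \<theta>
  proof (rule ccontr)
    assume "potential n G \<theta> \<noteq> \<infinity>"
    then have "8 ^ n * potential n G \<theta> < \<infinity>"
      by (simp add: ennreal_mult_less_top less_top power_less_top_ennreal)
    with G(3)[of \<theta>] that show False by auto
  qed
  then have "capacity n ?E = 0"
    by (rule capacity_eq_0I[OF G(1,2)])
  then show ?thesis
    unfolding quasi_everywhere_def by (intro exI[of _ ?E]) (auto simp: less_top)
qed

end
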